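(* Let $d$ and $k$ be integers with $1\le k\le d-1$ and let $\varepsilon\in(0,1)$. There exist a positive integer $r=r(d,\varepsilon,k)$ and a constant $c=c(d,\varepsilon,k)>0$ such that the following holds. Let $\Lambda\subseteq\mathbb{R}^d$ be a $d$-dimensional lattice and let $K\subseteq\mathbb{R}^d$ be a $d$-dimensional compact convex body symmetric about the origin, and write $\lambda_i=\lambda_i(\Lambda,K)$ for $i=1,\dots,d$. If $\lambda_d\le 1$, then there is a set $S\subseteq\Lambda\cap K$ with $|S|\ge c\,((1-\lambda_d)\beta)^{d-k-\varepsilon}$, where \[\beta=\min_{1\le j\le d-1}(\lambda_j\cdots\lambda_d)^{-1/(d-j)},\] such that every $k$-dimensional linear subspace of $\mathbb{R}^d$ contains at most $r-1$ points of $S$.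
   Context: A $d$-dimensional lattice is the set of all integer linear combinations of $d$ linearly independent vectors of $\mathbb{R}^d$. For a lattice $\Lambda$ and a compact convex body $K$ symmetric about the origin ($K=-K$), the $i$th successive minimum is $\lambda_i(\Lambda,K)=\inf\{\lambda\in\mathbb{R}:\dim(\Lambda\cap(\lambda K))\ge i\}$, where $\dim$ denotes the dimension of the affine hull. *)

theory Defs
  imports "HOL-Analysis.Analysis"
begin

definition is_lattice :: "(real^'n) set \<Rightarrow> bool" where
  "is_lattice L \<longleftrightarrow> (\<exists>b :: 'n \<Rightarrow> real^'n. inj b \<and> independent (range b) \<and>
      L = range (\<lambda>z :: 'n \<Rightarrow> int. \<Sum>i\<in>UNIV. of_int (z i) *\<^sub>R b i))"

definition sym_convex_body :: "(real^'n) set \<Rightarrow> bool" where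
  "sym_convex_body K \<longleftrightarrow> compact K \<and> convex K \<and> interior K \<noteq> {} \<and> uminus ` K = K"

definition succ_min :: "(real^'n) set \<Rightarrow> (real^'n) set \<Rightarrow> nat \<Rightarrow> real" where
  "succ_min L K i = Inf {l :: real. 0 < l \<and> aff_dim (L \<inter> ((\<lambda>x. l *\<^sub>R x) ` K)) \<ge> int i}"

definition beta_param :: "(real^'n) set \<Rightarrow> (real^'n) set \<Rightarrow> real" where
  "beta_param L K = Min ((\<lambda>j. (\<Prod>i\<in>{j..CARD('n)}. succ_min L K i)
        powr (- 1 / (real CARD('n) - real j))) ` {1..CARD('n) - 1})"

end

theory Submission
  imports Defs "HOL-Number_Theory.Cong"
begin

text \<open>Take linearly independent \<open>v 1, \<dots>, v d\<close> in \<open>\<Lambda>\<close> with \<open>v i \<in> \<mu> i K\<close>, where \<open>\<mu> i\<close> is slightly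
  larger than \<open>\<lambda> i\<close>, and let \<open>p\<close> be a prime of order almost \<open>(1 - \<lambda> d) \<beta>\<close>. Consider coordinate vectors
  modulo \<open>p\<close> with last coordinate 1. A \<open>k\<close>-dimensional subspace of \<open>\<real>\<^sup>d\<close> meets the lattice spanned by
  the \<open>v i\<close> in the integer combinations of \<open>k\<close> vectors, so it induces one of at most \<open>p ^ (d k)\<close>
  sets of residue vectors, each with at most \<open>p ^ (k - 1)\<close> elements in the chart. A random set of about
  \<open>p powr (d - k - \<epsilon>)\<close> residue vectors in the chart has fewer than \<open>r\<close> elements in every one of these.
  Each residue vector \<open>u\<close> has a nonzero multiple that lifts to a lattice point in \<open>K\<close>: if \<open>\<lambda> d\<close> is small
  this is a pigeonhole argument on the \<open>p\<close> multiples of \<open>u\<close>, and if \<open>\<lambda> d\<close> is bounded below then \<open>u\<close>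
  itself lifts, using the factor \<open>1 - \<lambda> d\<close>. Since the bound has \<open>\<epsilon>\<close> to spare, \<open>p\<close> may be a
  logarithmic factor too small, and the bound \<open>2 ^ n \<le> lcm {1..n + 1}\<close> provides such a prime.\<close>

section \<open>Primes below a given bound\<close>

text \<open>The numbers \<open>1 / (Suc n * (n choose k))\<close> form Leibniz's harmonic triangle.
  Its edge entries are \<open>1 / Suc n\<close>, which the lcm clears, and every other entry is a
  difference of two entries one column earlier, so integrality spreads by induction on the column
  \<open>k\<close>.\<close>

lemma Lcm_div_leibniz_triangle_in_Ints:
  assumes "k \<le> n" "n < N"
  shows "real (Lcm {1..N}) / real (Suc n * (n choose k)) \<in> \<int>"
  using assms
proof (induction k arbitrary: n)
  case 0
  then have "Suc n dvd Lcm {1..N}" by (intro dvd_Lcm) auto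
  then obtain q where "Lcm {1..N} = Suc n * q" by (rule dvdE)
  then have "real (Lcm {1..N}) / real (Suc n * (n choose 0)) = real q"
    by (simp only: of_nat_mult binomial_n_0 mult_1_right of_nat_1) (rule nonzero_mult_div_cancel_left, simp)
  then show ?case by simp
next
  case (Suc k)
  then obtain m where n: "n = Suc m" and km: "k \<le> m" by (cases n) auto
  define x where "x = real (n choose k)"
  have x: "x > 0" using Suc.prems by (simp add: x_def)
  have comp: "(n - k) * (n choose k) = n * (m choose k)"
    using binomial_absorb_comp[of n k] n by simp
  have "Suc k * (n choose Suc k) = (n - k) * (n choose k)"
    using binomial_absorption[of k n] comp n by (simp only: diff_Suc_1)
  then have "real (Suc k) * real (n choose Suc k) = real (n - k) * real (n choose k)"
    by (simp only: of_nat_mult[symmetric])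
  then have a: "real (Suc k) * real (n choose Suc k) = (real n - real k) * x"
    using Suc.prems by (simp only: x_def of_nat_diff)
  have "real (n - k) * real (n choose k) = real n * real (m choose k)"
    using comp by (simp only: of_nat_mult[symmetric])
  then have b: "real n * real (m choose k) = (real n - real k) * x"
    using Suc.prems by (simp add: x_def of_nat_diff)
  have nk: "real n - real k > 0" using Suc.prems by simp
  \<comment> \<open>The rule of the triangle, scaled by \<open>L\<close>. Both binomials
    \<open>n choose Suc k\<close> and \<open>m choose k\<close> have been expressed through
    \<open>x\<close> above, which leaves a partial fraction identity.\<close>
  have split: "L / real (Suc n * (n choose Suc k)) =
    L / real (Suc m * (m choose k)) - L / real (Suc n * (n choose k))" for L
  proof -
    have c: "real (n choose Suc k) = (real n - real k) * x / real (Suc k)"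
      using a by (simp add: field_simps)
    have "L / real (Suc n * (n choose Suc k)) = L * (real k + 1) / ((real n + 1) * ((real n - real k) * x))"
      unfolding of_nat_mult c by (simp add: field_simps)
    also have "\<dots> = L / ((real n - real k) * x) - L / ((real n + 1) * x)"
      using x nk by (simp add: divide_simps) (simp add: algebra_simps)
    also have "\<dots> = L / real (Suc m * (m choose k)) - L / real (Suc n * (n choose k))"
      using b n unfolding of_nat_mult by (simp add: x_def)
    finally show "L / real (Suc n * (n choose Suc k)) =
        L / real (Suc m * (m choose k)) - L / real (Suc n * (n choose k))" .
  qed
  have "real (Lcm {1..N}) / real (Suc m * (m choose k)) \<in> \<int>"
    "real (Lcm {1..N}) / real (Suc n * (n choose k)) \<in> \<int>"
    using Suc.prems km n by (rule_tac Suc.IH; simp)+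
  then show ?case unfolding split by (rule Ints_diff)
qed

text \<open>A positive integer quotient is at least 1, so each \<open>Suc n * (n choose k)\<close>
  is at most the lcm. Summing over the \<open>Suc n\<close> values of \<open>k\<close> turns the
  binomials into \<open>2 ^ n\<close>, and the factor \<open>Suc n\<close> cancels.\<close>

lemma two_power_le_Lcm: "2 ^ n \<le> Lcm {1..Suc n}"
proof -
  let ?L = "Lcm {1..Suc n}"
  have L0: "?L > 0" by (auto simp: zero_less_iff_neq_zero Lcm_0_iff)
  have "Suc n * (n choose k) \<le> ?L" if kn: "k \<le> n" for k
  proof -
    have pos: "0 < Suc n * (n choose k)" using kn by simp
    obtain z where z: "real ?L / real (Suc n * (n choose k)) = of_int z"
      using Lcm_div_leibniz_triangle_in_Ints[OF kn lessI] by (rule Ints_cases)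
    then have "of_int z > (0::real)" using L0 pos by (metis divide_pos_pos of_nat_0_less_iff)
    then have "1 \<le> (of_int z :: real)" by (simp add: int_one_le_iff_zero_less)
    then have "real (Suc n * (n choose k)) \<le> real ?L"
      using pos unfolding z[symmetric] by (metis le_divide_eq_1_pos of_nat_0_less_iff)
    then show ?thesis by (simp only: of_nat_le_iff)
  qed
  then have "(\<Sum>k\<le>n. Suc n * (n choose k)) \<le> (\<Sum>k\<le>n. ?L)" by (intro sum_mono) auto
  then have "Suc n * 2 ^ n \<le> Suc n * ?L" by (simp only: sum_distrib_left[symmetric] choose_row_sum) simp
  then show ?thesis by (simp only: Suc_mult_le_cancel1)
qed

text \<open>A prime power dividing the lcm already divides one of \<open>1..m\<close>, so it is at
  most \<open>m\<close>, and all prime factors lie in \<open>{1..Y}\<close>, so there are at most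
  \<open>Y\<close> of them. Counting them this crudely turns a lower bound for the lcm into one for
  the largest prime up to \<open>m\<close>.\<close>

lemma Lcm_le_power:
  assumes "1 \<le> m" and Y: "\<And>p. prime p \<Longrightarrow> p \<le> m \<Longrightarrow> p \<le> Y"
  shows "Lcm {1..m::nat} \<le> m ^ Y"
proof -
  let ?L = "Lcm {1..m}"
  have L0: "?L \<noteq> 0" by (auto simp: Lcm_0_iff)
  have mult: "p ^ multiplicity p (Lcm {1..m}) \<le> m" if "prime p" for p
    using \<open>1 \<le> m\<close>
  proof (induction m rule: dec_induct)
    case base then show ?case by simp
  next
    case (step n)
    have "{1..Suc n} = insert (Suc n) {1..n}" by auto
    then have "Lcm {1..Suc n} = lcm (Suc n) (Lcm {1..n})" by simp
    moreover have "Lcm {1..n} \<noteq> 0" by (auto simp: Lcm_0_iff)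
    ultimately have "multiplicity p (Lcm {1..Suc n}) =
        max (multiplicity p (Suc n)) (multiplicity p (Lcm {1..n}))"
      using multiplicity_lcm[of "Suc n" "Lcm {1..n}" p] that by (metis Suc_neq_Zero)
    moreover have "p ^ multiplicity p (Suc n) \<le> Suc n"
      by (intro dvd_imp_le multiplicity_dvd) auto
    ultimately show ?case using step.IH by (auto simp: max_def)
  qed
  have "?L dvd fact m" by (intro Lcm_least) (auto intro: dvd_fact)
  have "p \<in> {1..Y}" if "p \<in> prime_factors ?L" for p
  proof -
    have p: "prime p" "p dvd ?L" using that by (auto simp: in_prime_factors_iff)
    from p(2) \<open>?L dvd fact m\<close> have "p dvd fact m" by (rule dvd_trans)
    then have "p \<le> Y" using p(1) Y by (simp only: prime_dvd_fact_iff)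
    then show ?thesis using prime_ge_1_nat[OF p(1)] by simp
  qed
  then have "prime_factors ?L \<subseteq> {1..Y}" by blast
  then have card: "card (prime_factors ?L) \<le> Y" by (metis card_atLeastAtMost card_mono diff_Suc_1 finite_atLeastAtMost)
  have "?L = (\<Prod>p\<in>prime_factors ?L. p ^ multiplicity p ?L)"
    using L0 by (simp add: prod_prime_factors)
  also have "\<dots> \<le> (\<Prod>p\<in>prime_factors ?L. m)" by (intro prod_mono) (simp_all only: in_prime_factors_iff mult, simp)
  also have "\<dots> = m ^ card (prime_factors ?L)" by simp
  also have "\<dots> \<le> m ^ Y" using card assms(1) by (intro power_increasing) auto
  finally show ?thesis .
qed

text \<open>Comparing the two bounds for the lcm shows that the largest prime \<open>Y\<close> up to
  \<open>x\<close> is at least of order \<open>x / ln x\<close>. The exponent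
  \<open>\<theta> < 1\<close> absorbs the logarithm.\<close>

lemma prime_below_ge_powr:
  fixes \<theta> :: real
  assumes "0 < \<theta>" "\<theta> < 1"
  obtains C where "0 < C" "\<And>x. 2 \<le> x \<Longrightarrow> \<exists>p. prime p \<and> real p \<le> x \<and> x powr \<theta> \<le> C * real p"
proof
  \<comment> \<open>One factor 2 comes from \<open>m - 1 \<ge> m / 2\<close>, the other from
    \<open>x \<le> 2 * m\<close> and \<open>2 powr \<theta> \<le> 2\<close>; the denominator comes
    from bounding \<open>ln m\<close> by a power of \<open>m\<close>.\<close>
  define C where "C = 4 / ((1 - \<theta>) * ln 2)"
  show "0 < C" using assms by (simp add: C_def)
  fix x :: real assume x: "2 \<le> x"
  define m where "m = nat \<lfloor>x\<rfloor>"
  have m: "real m \<le> x" "x \<le> 2 * real m" "2 \<le> m" using x by (auto simp: m_def le_nat_iff) linarith+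
  define Y where "Y = Max {p. prime p \<and> p \<le> m}"
  have fin: "finite {p::nat. prime p \<and> p \<le> m}" by (rule finite_subset[of _ "{..m}"]) auto
  have ne: "{p::nat. prime p \<and> p \<le> m} \<noteq> {}" using m two_is_prime_nat by blast
  have Y: "prime Y" "Y \<le> m" using Max_in[OF fin ne] by (auto simp: Y_def)
  have "2 ^ (m - 1) \<le> Lcm {1..m}" using two_power_le_Lcm[of "m - 1"] m by simp
  also have "\<dots> \<le> m ^ Y" using m fin by (intro Lcm_le_power) (auto simp: Y_def)
  finally have "(2::real) ^ (m - 1) \<le> real m ^ Y" by (metis of_nat_le_iff of_nat_numeral of_nat_power)
  then have "ln ((2::real) ^ (m - 1)) \<le> ln (real m ^ Y)" using m by (subst ln_le_cancel_iff) auto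
  then have 1: "(real m - 1) * ln 2 \<le> real Y * ln (real m)" using m by (simp add: ln_realpow of_nat_diff)
  have 2: "ln (real m) \<le> real m powr (1 - \<theta>) / (1 - \<theta>)" using m assms by (intro ln_powr_bound) auto
  have "real m / 2 * ln 2 \<le> (real m - 1) * ln 2" using m by (intro mult_right_mono) auto
  also have "\<dots> \<le> real Y * (real m powr (1 - \<theta>) / (1 - \<theta>))"
    using 1 2 by (meson mult_left_mono of_nat_0_le_iff order_trans)
  also have "real m powr (1 - \<theta>) = real m / real m powr \<theta>" using m by (simp add: powr_diff)
  finally have "real m / 2 * ln 2 * (real m powr \<theta> * (1 - \<theta>)) \<le>
      real Y * (real m / real m powr \<theta> / (1 - \<theta>)) * (real m powr \<theta> * (1 - \<theta>))"
    using assms by (intro mult_right_mono) auto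
  also have "\<dots> = real Y * real m" using m assms by simp
  finally have "real m * (real m powr \<theta> * ((1 - \<theta>) * ln 2)) \<le> real m * (2 * real Y)"
    by (simp add: mult.commute mult.left_commute)
  then have "real m powr \<theta> * ((1 - \<theta>) * ln 2) \<le> 2 * real Y" using m by simp
  then have "real m powr \<theta> \<le> 2 * real Y / ((1 - \<theta>) * ln 2)"
    using m assms by (simp add: pos_le_divide_eq)
  moreover have "x powr \<theta> \<le> (2 * real m) powr \<theta>" using m x assms by (intro powr_mono2) auto
  moreover have "(2 * real m) powr \<theta> = 2 powr \<theta> * real m powr \<theta>" by (simp add: powr_mult)
  moreover have "2 powr \<theta> \<le> (2::real)" using powr_mono[of \<theta> 1 "2::real"] assms by simp
  moreover have "2 powr \<theta> * real m powr \<theta> \<le> 2 * real m powr \<theta>" using calculation by (intro mult_right_mono) auto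
  ultimately have "x powr \<theta> \<le> C * real Y" by (simp add: C_def)
  with Y m show "\<exists>p. prime p \<and> real p \<le> x \<and> x powr \<theta> \<le> C * real p" by (meson of_nat_le_iff order_trans)
qed

section \<open>Residue vectors avoiding low-dimensional concentration\<close>

text \<open>A union bound for a uniformly random \<open>s\<close>-subset of \<open>U\<close>,
  written as a count. There are at most \<open>card F * a ^ r\<close> sets \<open>T\<close> of
  \<open>r\<close> points inside some \<open>A i\<close>, and a given \<open>T\<close> is contained
  in the random set with probability \<open>(s choose r) / (n choose r)\<close>, which is at most
  \<open>(s * r / n) ^ r\<close>.\<close>

lemma exists_subset_card_Int_less:
  fixes U :: "'a set" and A :: "'b \<Rightarrow> 'a set"
  assumes U: "finite U" and F: "finite F" and a: "\<And>i. i \<in> F \<Longrightarrow> card (U \<inter> A i) \<le> a"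
    and s: "s \<le> card U" and r: "0 < r"
    and small: "s < r \<or> real (card F) * (real a * real s * real r / real (card U)) ^ r < 1"
  obtains R where "R \<subseteq> U" "card R = s" "\<And>i. i \<in> F \<Longrightarrow> card (R \<inter> A i) < r"
proof (cases "s < r")
  case True
  obtain R where R: "R \<subseteq> U" "card R = s" using s by (meson obtain_subset_with_card_n)
  have "card (R \<inter> A i) < r" for i
    using card_mono[of R "R \<inter> A i"] R U True finite_subset by (metis inf_le1 le_less_trans)
  with R that show ?thesis by blast
next
  case False
  define n where "n = card U"
  define Sub where "Sub = {R. R \<subseteq> U \<and> card R = s}"
  define Ext where "Ext T = {R. T \<subseteq> R \<and> R \<subseteq> U \<and> card R = s}" for T
  \<comment> \<open>The \<open>s\<close>-subsets that meet some \<open>A i\<close> in at least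
    \<open>r\<close> points. It suffices that they are fewer than all members of
    \<open>Sub\<close>.\<close>
  define Bad where "Bad = (\<Union>i\<in>F. \<Union>T\<in>{T. T \<subseteq> U \<inter> A i \<and> card T = r}. Ext T)"
  have n0: "r \<le> n" "0 < n" "s \<le> n" "r \<le> s" using False s r by (auto simp: n_def)
  have Ext: "card (Ext T) \<le> (n - r) choose (s - r)" if "T \<subseteq> U" "card T = r" for T
  proof -
    have "Ext T \<subseteq> (\<lambda>Q. T \<union> Q) ` {Q. Q \<subseteq> U - T \<and> card Q = s - r}"
    proof
      fix R assume "R \<in> Ext T"
      then have R: "T \<subseteq> R" "R \<subseteq> U" "card R = s" by (auto simp: Ext_def)
      then have "card (R - T) = s - r" using that U by (metis card_Diff_subset finite_subset)
      then show "R \<in> (\<lambda>Q. T \<union> Q) ` {Q. Q \<subseteq> U - T \<and> card Q = s - r}"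
        using R by (intro image_eqI[of _ _ "R - T"]) auto
    qed
    moreover have "finite {Q. Q \<subseteq> U - T \<and> card Q = s - r}" using U by simp
    ultimately have "card (Ext T) \<le> card {Q. Q \<subseteq> U - T \<and> card Q = s - r}"
      by (meson card_image_le card_mono finite_imageI order_trans)
    also have "\<dots> = card (U - T) choose (s - r)" using U by (intro n_subsets) simp
    also have "card (U - T) = n - r" using that U by (metis card_Diff_subset finite_subset n_def)
    finally show ?thesis .
  qed
  have "card Bad \<le> (\<Sum>i\<in>F. card (\<Union>T\<in>{T. T \<subseteq> U \<inter> A i \<and> card T = r}. Ext T))"
    unfolding Bad_def by (rule card_UN_le[OF F])
  also have "\<dots> \<le> (\<Sum>i\<in>F. a ^ r * ((n - r) choose (s - r)))"
  proof (rule sum_mono)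
    fix i assume i: "i \<in> F"
    let ?T = "{T. T \<subseteq> U \<inter> A i \<and> card T = r}"
    have fin: "finite ?T" using U by simp
    have "card (\<Union>T\<in>?T. Ext T) \<le> (\<Sum>T\<in>?T. card (Ext T))" by (rule card_UN_le[OF fin])
    also have "\<dots> \<le> (\<Sum>T\<in>?T. (n - r) choose (s - r))" by (intro sum_mono Ext) auto
    also have "\<dots> = card ?T * ((n - r) choose (s - r))" by simp
    also have "card ?T = card (U \<inter> A i) choose r" using U by (intro n_subsets) simp
    also have "\<dots> \<le> a ^ r"
    proof (cases "r \<le> card (U \<inter> A i)")
      case True
      then have "card (U \<inter> A i) choose r \<le> card (U \<inter> A i) ^ r" by (rule binomial_le_pow)
      also have "\<dots> \<le> a ^ r" using a[OF i] by (rule power_mono) simp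
      finally show ?thesis .
    qed (simp add: binomial_eq_0)
    finally show "card (\<Union>T\<in>?T. Ext T) \<le> a ^ r * ((n - r) choose (s - r))" by simp
  qed
  also have "\<dots> = card F * a ^ r * ((n - r) choose (s - r))" by simp
  finally have bad: "card Bad \<le> card F * a ^ r * ((n - r) choose (s - r))" .
  have nr: "(real n / real r) ^ r \<le> real (n choose r)"
    using n0 by (intro binomial_ge_n_over_k_pow_k) auto
  \<comment> \<open>Double count of pairs of an \<open>s\<close>-subset and an
    \<open>r\<close>-subset of it. It trades the number of extensions of \<open>T\<close> for the
    total number of \<open>s\<close>-subsets.\<close>
  have "(n choose s) * (s choose r) = (n choose r) * ((n - r) choose (s - r))"
    using n0 by (intro choose_mult) auto
  then have eq: "real (n choose r) * real ((n - r) choose (s - r)) = real (n choose s) * real (s choose r)"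
    by (metis of_nat_mult)
  have sr: "real (s choose r) \<le> real s ^ r" using n0 binomial_le_pow[of r s] by (metis of_nat_le_iff of_nat_power)
  have pos: "0 < real (n choose s)" using n0 by simp
  \<comment> \<open>The factor \<open>(n / r) ^ r\<close> stands in for \<open>n choose r\<close>;
    it is carried along on both sides and cancelled at the end.\<close>
  have "(real n / real r) ^ r * real (card Bad) \<le>
      (real n / real r) ^ r * (real (card F) * real a ^ r * real ((n - r) choose (s - r)))"
    using bad by (intro mult_left_mono) (metis of_nat_le_iff of_nat_mult of_nat_power, simp)
  also have "\<dots> = real (card F) * real a ^ r * ((real n / real r) ^ r * real ((n - r) choose (s - r)))"
    by simp
  also have "\<dots> \<le> real (card F) * real a ^ r * (real (n choose s) * real s ^ r)"
  proof (rule mult_left_mono)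
    have "(real n / real r) ^ r * real ((n - r) choose (s - r)) \<le> real (n choose r) * real ((n - r) choose (s - r))"
      using nr by (intro mult_right_mono) auto
    also have "\<dots> \<le> real (n choose s) * real s ^ r" unfolding eq using sr by (intro mult_left_mono) auto
    finally show "(real n / real r) ^ r * real ((n - r) choose (s - r)) \<le> real (n choose s) * real s ^ r" .
  qed simp
  also have "\<dots> = (real n / real r) ^ r * (real (n choose s) * (real (card F) * (real a * real s * real r / real n) ^ r))"
    using n0 r by (simp add: power_mult_distrib power_divide field_simps)
  also have "\<dots> < (real n / real r) ^ r * real (n choose s)"
    using small False n0 r pos by (intro mult_strict_left_mono) (auto simp: n_def)
  finally have "card Bad < n choose s" using n0 r by (simp del: binomial_eq_0_iff)
  also have "\<dots> = card Sub" unfolding Sub_def n_def using n_subsets[OF U] by simp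
  finally have "\<not> Sub \<subseteq> Bad"
  proof -
    assume *: "card Bad < card Sub"
    have "finite Bad" by (rule finite_subset[of _ "Pow U"]) (use U in \<open>auto simp: Bad_def Ext_def\<close>)
    with * show ?thesis using card_mono leD by blast
  qed
  then obtain R where R: "R \<in> Sub" "R \<notin> Bad" by auto
  have "card (R \<inter> A i) < r" if i: "i \<in> F" for i
  proof (rule ccontr)
    assume "\<not> ?thesis"
    then obtain T where "T \<subseteq> R \<inter> A i" "card T = r"
      by (meson not_less obtain_subset_with_card_n)
    then have "R \<in> Bad" using R(1) i unfolding Bad_def Ext_def Sub_def by blast
    then show False using R by simp
  qed
  with R that show ?thesis unfolding Sub_def by blast
qed

text \<open>The row space modulo \<open>p\<close> of an integer matrix with \<open>k\<close> rows,
  by canonical representatives. The entries of \<open>g\<close> stay unreduced so that generators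
  coming from integer points can be used as they are; extensional functions make the set
  finite.\<close>

definition residue_combinations :: "nat \<Rightarrow> nat \<Rightarrow> nat \<Rightarrow> (nat \<Rightarrow> nat \<Rightarrow> int) \<Rightarrow> (nat \<Rightarrow> int) set" where
  "residue_combinations p d k g =
    {u \<in> {1..d} \<rightarrow>\<^sub>E {0..<int p}. \<exists>c. \<forall>i\<in>{1..d}. [u i = (\<Sum>j<k. c j * g j i)] (mod int p)}"

text \<open>An affine chart of projective space modulo \<open>p\<close>: for prime \<open>p\<close>,
  distinct members are never proportional, so passing to multiples loses no points. Normalising
  coordinate \<open>d\<close> keeps the coefficient of the longest lattice vector equal to
  1.\<close>

definition residue_chart :: "nat \<Rightarrow> nat \<Rightarrow> (nat \<Rightarrow> int) set" where
  "residue_chart p d = {u \<in> {1..d} \<rightarrow>\<^sub>E {0..<int p}. u d = 1}"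

lemma card_residue_combinations_le:
  assumes "0 < p"
  shows "card (residue_combinations p d k g) \<le> p ^ k"
proof -
  let ?f = "\<lambda>c. \<lambda>i\<in>{1..d}. (\<Sum>j<k. c j * g j i) mod int p"
  have "residue_combinations p d k g \<subseteq> ?f ` ({..<k} \<rightarrow>\<^sub>E {0..<int p})"
  proof
    fix u assume "u \<in> residue_combinations p d k g"
    then obtain c where u: "u \<in> {1..d} \<rightarrow>\<^sub>E {0..<int p}"
      and c: "\<And>i. i \<in> {1..d} \<Longrightarrow> [u i = (\<Sum>j<k. c j * g j i)] (mod int p)"
      unfolding residue_combinations_def by blast
    let ?c = "\<lambda>j\<in>{..<k}. c j mod int p"
    have "u = ?f ?c"
    proof
      fix i
      show "u i = ?f ?c i"
      proof (cases "i \<in> {1..d}")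
        case True
        have "[(\<Sum>j<k. ?c j * g j i) = (\<Sum>j<k. c j * g j i)] (mod int p)"
          by (intro cong_sum cong_mult) (auto simp: cong_def)
        then have "[u i = (\<Sum>j<k. ?c j * g j i)] (mod int p)" using c[OF True] by (metis cong_trans cong_sym)
        moreover have "u i mod int p = u i" using True u by (auto simp: PiE_iff)
        ultimately show ?thesis using True by (simp add: cong_def)
      next
        case False
        then show ?thesis using u by (auto simp: PiE_iff extensional_def)
      qed
    qed
    moreover have "?c \<in> {..<k} \<rightarrow>\<^sub>E {0..<int p}" using assms by (auto simp: PiE_iff)
    ultimately show "u \<in> ?f ` ({..<k} \<rightarrow>\<^sub>E {0..<int p})" by blast
  qed
  then have "card (residue_combinations p d k g) \<le> card ({..<k} \<rightarrow>\<^sub>E {0..<int p})"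
    by (meson card_image_le card_mono finite_PiE finite_atLeastLessThan_int finite_imageI finite_lessThan order_trans)
  then show ?thesis by (simp add: card_PiE)
qed

text \<open>Translating by the multiples of one point of the chart gives \<open>p\<close> disjoint copies of the
  intersection inside the set of combinations.\<close>

lemma card_chart_Int_combinations_le:
  assumes p: "1 < p" and d: "1 \<le> d" and k: "1 \<le> k"
  shows "card (residue_chart p d \<inter> residue_combinations p d k g) \<le> p ^ (k - 1)"
proof (cases "residue_chart p d \<inter> residue_combinations p d k g = {}")
  case False
  let ?U = "residue_chart p d" and ?W = "residue_combinations p d k g"
  obtain v where v: "v \<in> ?U" "v \<in> ?W" using False by auto
  obtain cv where cv: "\<And>i. i \<in> {1..d} \<Longrightarrow> [v i = (\<Sum>j<k. cv j * g j i)] (mod int p)"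
    using v unfolding residue_combinations_def by blast
  let ?f = "\<lambda>(t, u). \<lambda>i\<in>{1..d}. (u i + t * v i) mod int p"
  have inj: "inj_on ?f ({0..<int p} \<times> (?U \<inter> ?W))"
  proof (rule inj_onI, clarify)
    fix t u t' u'
    assume t: "t \<in> {0..<int p}" "t' \<in> {0..<int p}" and u: "u \<in> ?U" "u' \<in> ?U"
      and eq: "(\<lambda>i\<in>{1..d}. (u i + t * v i) mod int p) = (\<lambda>i\<in>{1..d}. (u' i + t' * v i) mod int p)"
    have e: "(u i + t * v i) mod int p = (u' i + t' * v i) mod int p" if "i \<in> {1..d}" for i
      using fun_cong[OF eq, of i] that by simp
    \<comment> \<open>All three chart vectors have last coordinate 1, so coordinate \<open>d\<close>
      of the translate reveals the multiplier.\<close>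
    have "[1 + t = 1 + t'] (mod int p)"
      using e[of d] d u v by (simp add: residue_chart_def cong_def)
    then have "[t = t'] (mod int p)" by (simp add: cong_add_lcancel)
    then have tt: "t = t'" using t by (simp add: cong_def)
    have "u i = u' i" if i: "i \<in> {1..d}" for i
    proof -
      have "[u i = u' i] (mod int p)" using e[OF i] unfolding tt by (simp add: cong_def[symmetric] cong_add_rcancel)
      moreover have "u i \<in> {0..<int p}" "u' i \<in> {0..<int p}" using u i unfolding residue_chart_def PiE_iff by blast+
      ultimately show ?thesis by (simp add: cong_def)
    qed
    then have "u = u'" using u by (intro PiE_ext[of u "{1..d}" _ u']) (auto simp: residue_chart_def)
    with tt show "t = t' \<and> u = u'" by simp
  qed
  have sub: "?f ` ({0..<int p} \<times> (?U \<inter> ?W)) \<subseteq> ?W"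
  proof (rule image_subsetI, clarify)
    fix t u assume "u \<in> ?W"
    then obtain c where c: "\<And>i. i \<in> {1..d} \<Longrightarrow> [u i = (\<Sum>j<k. c j * g j i)] (mod int p)"
      unfolding residue_combinations_def by blast
    have "[(\<lambda>i\<in>{1..d}. (u i + t * v i) mod int p) i = (\<Sum>j<k. (c j + t * cv j) * g j i)] (mod int p)"
      if i: "i \<in> {1..d}" for i
    proof -
      have "[u i + t * v i = (\<Sum>j<k. c j * g j i) + t * (\<Sum>j<k. cv j * g j i)] (mod int p)"
        using c[OF i] cv[OF i] by (intro cong_add cong_mult) auto
      also have "(\<Sum>j<k. c j * g j i) + t * (\<Sum>j<k. cv j * g j i) = (\<Sum>j<k. (c j + t * cv j) * g j i)"
        by (simp add: sum.distrib sum_distrib_left algebra_simps)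
      finally show ?thesis using i by (simp add: cong_def)
    qed
    then show "(\<lambda>i\<in>{1..d}. (u i + t * v i) mod int p) \<in> ?W"
      using p unfolding residue_combinations_def by (auto intro!: exI[of _ "\<lambda>j. c j + t * cv j"])
  qed
  have "finite ({1..d} \<rightarrow>\<^sub>E {0..<int p})" by (intro finite_PiE) auto
  then have "finite ?W" by (rule finite_subset[rotated]) (auto simp: residue_combinations_def)
  then have "card ({0..<int p} \<times> (?U \<inter> ?W)) \<le> card ?W"
    using card_inj_on_le[OF inj sub] by simp
  also have "\<dots> \<le> p ^ k" using p by (intro card_residue_combinations_le) simp
  also have "\<dots> = p * p ^ (k - 1)" using k by (cases k) auto
  finally show ?thesis using p by (simp add: card_cartesian_product)
qed simp

lemma card_residue_chart:
  assumes p: "1 < p" and d: "1 \<le> d"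
  shows "card (residue_chart p d) = p ^ (d - 1)"
proof -
  have "residue_chart p d = (\<Pi>\<^sub>E i\<in>{1..d}. if i = d then {1} else {0..<int p})"
  proof (intro set_eqI iffI)
    fix u assume u: "u \<in> residue_chart p d"
    show "u \<in> (\<Pi>\<^sub>E i\<in>{1..d}. if i = d then {1} else {0..<int p})"
      using u by (intro PiE_I) (auto simp: residue_chart_def PiE_iff extensional_def)
  next
    fix u assume u: "u \<in> (\<Pi>\<^sub>E i\<in>{1..d}. if i = d then {1} else {0..<int p})"
    then have "u i \<in> (if i = d then {1} else {0..<int p})" if "i \<in> {1..d}" for i
      using that by (rule PiE_mem)
    then have i: "u i \<in> {0..<int p}" "u d = 1" if "i \<in> {1..d}" for i
      using that p d by (fastforce split: if_splits)+
    moreover have "u \<in> extensional {1..d}" using u by (simp add: PiE_def)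
    ultimately show "u \<in> residue_chart p d" using d unfolding residue_chart_def PiE_iff by auto
  qed
  then have "card (residue_chart p d) = (\<Prod>i\<in>{1..d}. if i = d then 1 else p)"
    by (simp add: card_PiE if_distrib cong: if_cong)
  also have "\<dots> = (\<Prod>i\<in>{1..d} - {d}. p)" by (subst prod.remove[of _ d]) (use d in auto)
  also have "\<dots> = p ^ (d - 1)" using d by (simp add: card_Diff_subset)
  finally show ?thesis .
qed

text \<open>In the union bound take \<open>a = p ^ (k - 1)\<close>,
  \<open>card U = p ^ (d - 1)\<close> and \<open>p ^ (d * k)\<close> generator matrices. With
  \<open>s\<close> of order \<open>p powr (d - k - \<epsilon>)\<close> the \<open>r\<close>th power
  is at most \<open>p powr (- \<epsilon> * r)\<close>, which beats the number of matrices once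
  \<open>\<epsilon> * r > d * k\<close>. Hence \<open>r\<close> does not depend on
  \<open>p\<close>.\<close>

lemma exists_subset_residue_chart:
  fixes \<epsilon> :: real
  assumes \<epsilon>: "0 < \<epsilon>" and k: "1 \<le> k" "k < d"
  obtains r where "2 \<le> r" "\<And>p. 1 < p \<Longrightarrow> \<exists>R \<subseteq> residue_chart p d.
     real p powr (real d - real k - \<epsilon>) / (2 * real r) \<le> real (card R) \<and>
     (\<forall>g. card (R \<inter> residue_combinations p d k g) \<le> r - 1)"
proof
  define r where "r = nat \<lceil>real (d * k) / \<epsilon>\<rceil> + 2"
  show r2: "2 \<le> r" by (simp add: r_def)
  have rk: "real (d * k) < \<epsilon> * real r"
  proof -
    have "real (d * k) / \<epsilon> < real r" unfolding r_def by linarith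
    then show ?thesis using \<epsilon> by (simp add: field_simps)
  qed
  fix p :: nat assume p: "1 < p"
  define z where "z = real p powr (real d - real k - \<epsilon>) / (2 * real r)"
  \<comment> \<open>Rounding up in this way gives \<open>s \<ge> max 1 z\<close>, and
    \<open>s \<le> 2 * z\<close> once \<open>z \<ge> 1\<close>. The 2 in the denominator of
    \<open>z\<close> pays for this doubling.\<close>
  define s where "s = nat \<lfloor>z\<rfloor> + 1"
  have z0: "0 \<le> z" by (simp add: z_def)
  have sz: "z \<le> real s" unfolding s_def by linarith
  let ?U = "residue_chart p d"
  have dk: "d \<ge> 1" using k by simp
  have cU: "card ?U = p ^ (d - 1)" using p dk by (rule card_residue_chart)
  have fU: "finite ?U" using cU p by (metis card.infinite less_nat_zero_code not_less_zero power_eq_0_iff zero_less_one)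
  define F where "F = ({..<k} \<rightarrow>\<^sub>E ({1..d} \<rightarrow>\<^sub>E {0..<int p}))"
  have cF: "card F = p ^ (d * k)" by (simp add: F_def card_PiE power_mult)
  have fF: "finite F" unfolding F_def by (intro finite_PiE) auto
  have s2: "real s \<le> 2 * z" if "\<not> s < r"
  proof -
    have "1 \<le> z" using that r2 unfolding s_def by linarith
    then show ?thesis unfolding s_def by linarith
  qed
  have z2: "2 * z * real r = real p powr (real d - real k - \<epsilon>)" using r2 by (simp add: z_def)
  have sU: "s \<le> card ?U"
  proof (cases "s < r")
    case True
    show ?thesis
    proof (cases "z < 1")
      case True
      then have "s = 1" using z0 by (simp add: s_def)
      then show ?thesis using cU p by simp
    next
      case False
      then have "real s \<le> 2 * z" unfolding s_def by linarith
      also have "\<dots> \<le> 2 * z * real r" using r2 z0 by (simp add: mult_le_cancel_left1)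
      also have "\<dots> \<le> real p powr (real (d - 1))" unfolding z2 using p k \<epsilon> by (intro powr_mono) auto
      also have "\<dots> = real (p ^ (d - 1))" using p by (simp add: powr_realpow)
      finally show ?thesis unfolding cU by (simp only: of_nat_le_iff)
    qed
  next
    case False
    have "real s \<le> 2 * z" using s2[OF False] .
    also have "\<dots> \<le> 2 * z * real r" using r2 z0 by (simp add: mult_le_cancel_left1)
    also have "\<dots> \<le> real p powr (real (d - 1))" unfolding z2 using p k \<epsilon> by (intro powr_mono) auto
    also have "\<dots> = real (p ^ (d - 1))" using p by (simp add: powr_realpow)
    finally show ?thesis unfolding cU by (simp only: of_nat_le_iff)
  qed
  have small: "s < r \<or> real (card F) * (real (p ^ (k - 1)) * real s * real r / real (card ?U)) ^ r < 1"
  proof (cases "s < r")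
    case False
    from s2[OF this] have "real (p ^ (k - 1)) * real s * real r / real (card ?U)
        \<le> real (p ^ (k - 1)) * (2 * z) * real r / real (card ?U)"
      by (intro divide_right_mono mult_right_mono mult_left_mono) auto
    also have "\<dots> = real (p ^ (k - 1)) * (2 * z * real r) / real (card ?U)" by simp
    also have "\<dots> = real p powr (real k - 1) * real p powr (real d - real k - \<epsilon>) / real p powr (real d - 1)"
      unfolding z2 cU using p k by (simp add: powr_realpow[symmetric] of_nat_diff)
    also have "\<dots> = real p powr (- \<epsilon>)" using p
      by (simp add: powr_add[symmetric] powr_diff[symmetric])
    finally have "(real (p ^ (k - 1)) * real s * real r / real (card ?U)) ^ r \<le> (real p powr (- \<epsilon>)) ^ r"
      by (intro power_mono) auto
    also have "\<dots> = real p powr (- \<epsilon> * real r)" using p by (simp add: powr_realpow[symmetric] powr_powr)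
    finally have "real (card F) * (real (p ^ (k - 1)) * real s * real r / real (card ?U)) ^ r
        \<le> real (card F) * real p powr (- \<epsilon> * real r)" by (intro mult_left_mono) auto
    also have "\<dots> = real p powr (real (d * k) + (- \<epsilon> * real r))"
      unfolding cF powr_add using p by (simp add: powr_realpow[symmetric])
    also have "\<dots> < real p powr 0" using rk p by (intro powr_less_mono) auto
    finally show ?thesis using p by simp
  qed simp
  obtain R where R: "R \<subseteq> ?U" "card R = s" and
    Rg: "\<And>g. g \<in> F \<Longrightarrow> card (R \<inter> residue_combinations p d k g) < r"
    using exists_subset_card_Int_less[where A = "residue_combinations p d k",
        OF fU fF card_chart_Int_combinations_le[OF p dk k(1)] sU _ small] r2 by (metis zero_less_numeral less_le_trans)
  have "card (R \<inter> residue_combinations p d k g) \<le> r - 1" for g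
  proof -
    \<comment> \<open>An arbitrary integer matrix has the same row space modulo \<open>p\<close> as
      its reduction, which lies in the finite family \<open>F\<close>.\<close>
    let ?g = "\<lambda>j\<in>{..<k}. \<lambda>i\<in>{1..d}. g j i mod int p"
    have "?g \<in> F" using p by (auto simp: F_def)
    moreover have "residue_combinations p d k ?g = residue_combinations p d k g"
    proof -
      have "[(\<Sum>j<k. c j * ?g j i) = (\<Sum>j<k. c j * g j i)] (mod int p)" if "i \<in> {1..d}" for c i
        using that by (intro cong_sum cong_mult) (auto simp: cong_def)
      then have "[x = (\<Sum>j<k. c j * ?g j i)] (mod int p) \<longleftrightarrow> [x = (\<Sum>j<k. c j * g j i)] (mod int p)"
        if "i \<in> {1..d}" for c i x using that unfolding cong_def by presburger
      then show ?thesis unfolding residue_combinations_def by (intro Collect_cong conj_cong refl ex_cong1 ball_cong)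
    qed
    ultimately show ?thesis using Rg[of ?g] by simp
  qed
  then show "\<exists>R \<subseteq> ?U. real p powr (real d - real k - \<epsilon>) / (2 * real r) \<le> real (card R) \<and>
     (\<forall>g. card (R \<inter> residue_combinations p d k g) \<le> r - 1)"
    using R sz unfolding z_def by blast
qed

section \<open>Integer coordinates along an independent sequence\<close>

text \<open>As for the Hermite normal form, induction on the number of coordinates with Euclidean
  division in the last one. The coefficients \<open>c\<close> are integers and not merely reals, so
  the relation survives reduction modulo \<open>p\<close>; the number of generators is bounded by
  the real dimension.\<close>

lemma integer_points_subset_combinations:
  fixes v :: "nat \<Rightarrow> 'a::euclidean_space"
  assumes v: "\<And>i. i \<in> {1..m} \<Longrightarrow> v i \<notin> span (v ` {1..<i})"
    and G: "\<And>w w' n. w \<in> G \<Longrightarrow> w' \<in> G \<Longrightarrow> (\<lambda>i. w i - n * w' i) \<in> G"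
    and dim: "dim ((\<lambda>w. \<Sum>i=1..m. of_int (w i) *\<^sub>R v i) ` G) \<le> k"
  shows "\<exists>g :: nat \<Rightarrow> nat \<Rightarrow> int. \<forall>w\<in>G. \<exists>c. \<forall>i\<in>{1..m}. w i = (\<Sum>j<k. c j * g j i)"
  using assms
proof (induction m arbitrary: G k)
  case 0
  then show ?case by simp
next
  case (Suc m)
  let ?\<phi> = "\<lambda>m w. \<Sum>i=1..m. of_int (w i) *\<^sub>R v i"
  have \<phi>0: "?\<phi> (Suc m) w = ?\<phi> m w" if "w (Suc m) = (0::int)" for w
    using that by simp
  have vm: "v i \<notin> span (v ` {1..<i})" if "i \<in> {1..m}" for i
    using Suc.prems(1) that by simp
  show ?case
  proof (cases "\<forall>w\<in>G. w (Suc m) = 0")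
    case True
    then have "?\<phi> (Suc m) ` G = ?\<phi> m ` G" by (intro image_cong refl \<phi>0) blast
    then have "dim (?\<phi> m ` G) \<le> k" using Suc.prems(3) by simp
    from Suc.IH[OF vm Suc.prems(2) this] obtain g :: "nat \<Rightarrow> nat \<Rightarrow> int"
      where g: "\<forall>w\<in>G. \<exists>c. \<forall>i\<in>{1..m}. w i = (\<Sum>j<k. c j * g j i)" by blast
    show ?thesis
    \<comment> \<open>The induction hypothesis says nothing about coordinate \<open>Suc m\<close> of
      the generators, so it is overwritten by 0.\<close>
    proof (intro exI[of _ "\<lambda>j. (g j)(Suc m := 0)"] ballI)
      fix w assume w: "w \<in> G"
      then obtain c where c: "\<forall>i\<in>{1..m}. w i = (\<Sum>j<k. c j * g j i)" using g by blast
      show "\<exists>c. \<forall>i\<in>{1..Suc m}. w i = (\<Sum>j<k. c j * ((g j)(Suc m := 0)) i)"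
        using c True w by (intro exI[of _ c]) (auto simp: le_Suc_eq)
    qed
  next
    case False
    define Q where "Q w \<longleftrightarrow> w \<in> G \<and> w (Suc m) \<noteq> 0" for w
    have "\<exists>w. Q w" using False by (auto simp: Q_def)
    \<comment> \<open>\<open>w0\<close> will be the additional generator: its last coordinate is a
      nonzero one of least absolute value.\<close>
    then obtain w0 where w0: "Q w0" and min: "\<And>w. Q w \<Longrightarrow> nat \<bar>w0 (Suc m)\<bar> \<le> nat \<bar>w (Suc m)\<bar>"
      using ex_has_least_nat[of Q _ "\<lambda>w. nat \<bar>w (Suc m)\<bar>"] by blast
    have w0G: "w0 \<in> G" and w00: "w0 (Suc m) \<noteq> 0" using w0 by (auto simp: Q_def)
    define G0 where "G0 = {w \<in> G. w (Suc m) = 0}"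
    let ?V = "span (v ` {1..m})"
    have \<phi>V: "?\<phi> m w \<in> ?V" for w :: "nat \<Rightarrow> int"
      by (intro span_sum span_scale span_base) auto
    have "?\<phi> (Suc m) ` G0 \<subseteq> ?V" using \<phi>V \<phi>0 by (auto simp: G0_def)
    then have sub: "span (?\<phi> (Suc m) ` G0) \<subseteq> ?V" by (simp add: span_minimal)
    \<comment> \<open>Since \<open>w0\<close> leaves the span of the first \<open>m\<close> vectors,
      \<open>G0\<close> has dimension at most \<open>k - 1\<close>, which leaves room for
      \<open>w0\<close> among the \<open>k\<close> generators.\<close>
    have "?\<phi> (Suc m) w0 \<notin> ?V"
    proof
      assume "?\<phi> (Suc m) w0 \<in> ?V"
      then have "?\<phi> (Suc m) w0 - ?\<phi> m w0 \<in> ?V" using \<phi>V by (rule span_diff)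
      then have "of_int (w0 (Suc m)) *\<^sub>R v (Suc m) \<in> ?V" by simp
      then have "(1 / of_int (w0 (Suc m))) *\<^sub>R (of_int (w0 (Suc m)) *\<^sub>R v (Suc m)) \<in> ?V"
        by (rule span_scale)
      then have "v (Suc m) \<in> ?V" using w00 by simp
      then show False using Suc.prems(1)[of "Suc m"] by (simp add: atLeastLessThanSuc_atLeastAtMost)
    qed
    then have notin: "?\<phi> (Suc m) w0 \<notin> span (?\<phi> (Suc m) ` G0)" using sub by blast
    have "insert (?\<phi> (Suc m) w0) (?\<phi> (Suc m) ` G0) \<subseteq> ?\<phi> (Suc m) ` G"
      using w0G by (intro insert_subsetI image_mono imageI) (simp_all add: G0_def)
  then have "dim (insert (?\<phi> (Suc m) w0) (?\<phi> (Suc m) ` G0)) \<le> k"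
      using Suc.prems(3) dim_subset order_trans by blast
    then have dk: "dim (?\<phi> (Suc m) ` G0) + 1 \<le> k" using notin by (simp add: dim_insert del: sum.cl_ivl_Suc)
    then obtain k' where k': "k = Suc k'" by (cases k) auto
    have "?\<phi> (Suc m) ` G0 = ?\<phi> m ` G0" by (intro image_cong refl \<phi>0) (simp add: G0_def)
    then have "dim (?\<phi> m ` G0) \<le> k'" using dk k' by simp
    moreover have "(\<lambda>i. w i - n * w' i) \<in> G0" if "w \<in> G0" "w' \<in> G0" for w w' n
      using that Suc.prems(2) by (auto simp: G0_def)
    ultimately obtain g :: "nat \<Rightarrow> nat \<Rightarrow> int"
      where g: "\<forall>w\<in>G0. \<exists>c. \<forall>i\<in>{1..m}. w i = (\<Sum>j<k'. c j * g j i)" using Suc.IH[OF vm] by blast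
    define h where "h j = (if j = k' then w0 else (g j)(Suc m := 0))" for j
    have "\<exists>c. \<forall>i\<in>{1..Suc m}. w i = (\<Sum>j<k. c j * h j i)" if w: "w \<in> G" for w
    proof -
      \<comment> \<open>The remainder is smaller than the last coordinate of \<open>w0\<close> in
        absolute value, so by minimality it is 0 and \<open>w'\<close> lies in
        \<open>G0\<close>.\<close>
      define q where "q = w (Suc m) div w0 (Suc m)"
      define w' where "w' i = w i - q * w0 i" for i
      have w'G: "w' \<in> G" unfolding w'_def using w w0G Suc.prems(2) by blast
      have "w' (Suc m) = w (Suc m) mod w0 (Suc m)" by (simp add: w'_def q_def minus_div_mult_eq_mod)
      then have "\<bar>w' (Suc m)\<bar> < \<bar>w0 (Suc m)\<bar>" using abs_mod_less[OF w00] by simp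
      then have "\<not> Q w'" using min[of w'] by linarith
      then have z: "w' (Suc m) = 0" using w'G by (simp add: Q_def)
      then have "w' \<in> G0" using w'G by (simp add: G0_def)
      then obtain c where c: "\<forall>i\<in>{1..m}. w' i = (\<Sum>j<k'. c j * g j i)" using g by blast
      have "w i = (\<Sum>j<k. (c(k' := q)) j * h j i)" if i: "i \<in> {1..Suc m}" for i
      proof -
        have "w' i = (\<Sum>j<k'. c j * ((g j)(Suc m := 0)) i)"
          using c i z by (cases "i = Suc m") auto
        then show ?thesis unfolding k' by (simp add: h_def w'_def)
      qed
      then show ?thesis by blast
    qed
    then show ?thesis by blast
  qed
qed

text \<open>Greedy choice: a set of dimension at least \<open>i\<close> does not fit into the span
  of the \<open>i - 1\<close> vectors chosen before.\<close>

lemma exists_independent_sequence: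
  fixes A :: "nat \<Rightarrow> 'a::euclidean_space set"
  assumes "\<And>i. i \<in> {1..d} \<Longrightarrow> i \<le> dim (A i)"
  shows "\<exists>v. \<forall>i\<in>{1..d}. v i \<in> A i \<and> v i \<notin> span (v ` {1..<i})"
  using assms
proof (induction d)
  case 0
  then show ?case by simp
next
  case (Suc d)
  then obtain v where v: "\<forall>i\<in>{1..d}. v i \<in> A i \<and> v i \<notin> span (v ` {1..<i})" by auto
  have "dim (v ` {1..d}) \<le> card (v ` {1..d})" by (intro dim_le_card') auto
  also have "\<dots> \<le> d" using card_image_le[of "{1..d}" v] by simp
  finally have "dim (v ` {1..d}) < dim (A (Suc d))" using Suc.prems[of "Suc d"] by simp
  then have "\<not> A (Suc d) \<subseteq> span (v ` {1..d})"
    using dim_subset[of "A (Suc d)" "span (v ` {1..d})"] by (auto simp: dim_span)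
  then obtain x where x: "x \<in> A (Suc d)" "x \<notin> span (v ` {1..d})" by blast
  have img: "(v(Suc d := x)) ` {1..<i} = v ` {1..<i}" if "i \<le> Suc d" for i
    using that by (intro image_cong) auto
  have "(v(Suc d := x)) i \<in> A i \<and> (v(Suc d := x)) i \<notin> span ((v(Suc d := x)) ` {1..<i})"
    if "i \<in> {1..Suc d}" for i
    using that v x img[of i] by (cases "i = Suc d") (auto simp: atLeastLessThanSuc_atLeastAtMost)
  then show ?case by blast
qed

text \<open>The triangle inequality for the gauge of \<open>K\<close>. Signs are moved onto the
  points, and the missing weight \<open>1 - s\<close> is put on the origin.\<close>

lemma sum_scaleR_mem_symmetric_convex:
  fixes K :: "'a::real_vector set"
  assumes K: "convex K" "0 \<in> K" "\<And>x. x \<in> K \<Longrightarrow> - x \<in> K"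
    and fin: "finite I" and a: "(\<Sum>i\<in>I. \<bar>a i\<bar>) \<le> 1" and x: "\<And>i. i \<in> I \<Longrightarrow> x i \<in> K"
  shows "(\<Sum>i\<in>I. a i *\<^sub>R x i) \<in> K"
proof -
  define s where "s = (\<Sum>i\<in>I. \<bar>a i\<bar>)"
  have s0: "0 \<le> s" by (simp add: s_def sum_nonneg)
  show ?thesis
  proof (cases "s = 0")
    case True
    then have "a i = 0" if "i \<in> I" for i using that fin by (simp add: s_def sum_nonneg_eq_0_iff)
    then show ?thesis using K by simp
  next
    case False
    define y where "y i = sgn (a i) *\<^sub>R x i" for i
    have y: "y i \<in> K" if "i \<in> I" for i
      using x[OF that] K by (auto simp: y_def sgn_if)
    have "(\<Sum>i\<in>I. (\<bar>a i\<bar> / s) *\<^sub>R y i) \<in> K"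
      using K y fin s0 False by (intro convex_sum) (auto simp: s_def sum_divide_distrib[symmetric])
    then have "s *\<^sub>R (\<Sum>i\<in>I. (\<bar>a i\<bar> / s) *\<^sub>R y i) + (1 - s) *\<^sub>R 0 \<in> K"
      using K a s0 by (intro convexD) (auto simp: s_def)
    moreover have "s *\<^sub>R (\<Sum>i\<in>I. (\<bar>a i\<bar> / s) *\<^sub>R y i) = (\<Sum>i\<in>I. a i *\<^sub>R x i)"
      unfolding scaleR_sum_right using False by (intro sum.cong refl) (simp add: y_def abs_mult_sgn)
    ultimately show ?thesis by simp
  qed
qed

section \<open>Short multiples modulo a prime\<close>

text \<open>Dirichlet's pigeonhole argument. Cut the residues in coordinate \<open>i\<close> into
  blocks of length \<open>h i\<close>; there are fewer boxes than multiples \<open>t * u\<close>, so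
  two multiples share a box and their difference is short in every coordinate.\<close>

lemma exists_short_multiple_mod:
  fixes \<mu> :: "nat \<Rightarrow> real" and u :: "nat \<Rightarrow> int"
  assumes p: "1 < p" and d: "1 \<le> d" and \<mu>: "\<And>i. i \<in> {1..d} \<Longrightarrow> 0 < \<mu> i"
    and prod: "(\<Prod>i=1..d. max 1 (2 * real d * real p * \<mu> i)) < real p"
  obtains t w where "0 < t" "t < int p" "\<And>i. i \<in> {1..d} \<Longrightarrow> [w i = t * u i] (mod int p)"
    "(\<Sum>i=1..d. \<bar>of_int (w i)\<bar> * \<mu> i) \<le> 1"
proof -
  \<comment> \<open>Two residues in one block differ by at most \<open>h i - 1\<close>, hence by at
    most \<open>1 / (d * \<mu> i)\<close>: each coordinate contributes at most \<open>1 / d\<close>.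
    \<open>N i\<close> is the number of blocks meeting \<open>0..p - 1\<close>.\<close>
  define h where "h i = nat \<lfloor>1 / (real d * \<mu> i)\<rfloor> + 1" for i
  define N where "N i = (p - 1) div h i + 1" for i
  have N: "real (N i) \<le> max 1 (2 * real d * real p * \<mu> i)" if i: "i \<in> {1..d}" for i
  proof (cases "h i < p")
    case False
    then show ?thesis by (simp add: N_def h_def)
  next
    case True
    have h0: "0 < real (h i)" by (simp add: h_def)
    have dm: "0 < real d * \<mu> i" using d \<mu>[OF i] by simp
    have "1 / (real d * \<mu> i) < real (h i)" unfolding h_def by linarith
    then have hd: "1 / real (h i) < real d * \<mu> i" using h0 dm by (simp add: field_simps)
    have "real ((p - 1) div h i) \<le> real (p - 1) / real (h i)" by (rule of_nat_div_le_of_nat)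
    also have "\<dots> \<le> real p / real (h i)" by (intro divide_right_mono) auto
    finally have "real (N i) \<le> real p / real (h i) + 1" by (simp add: N_def)
    also have "1 \<le> real p / real (h i)" using True h0 by simp
    also have "real p / real (h i) + real p / real (h i) = 2 * real p * (1 / real (h i))" by simp
    also have "\<dots> \<le> 2 * real p * (real d * \<mu> i)" using hd by (intro mult_left_mono) auto
    finally show ?thesis by (simp add: mult_ac)
  qed
  define f where "f t = (\<lambda>i\<in>{1..d}. nat ((t * u i) mod int p) div h i)" for t
  have "real (\<Prod>i=1..d. N i) < real p"
    using prod_mono[of "{1..d}" "\<lambda>i. real (N i)" "\<lambda>i. max 1 (2 * real d * real p * \<mu> i)"] N prod by simp
  then have "(\<Prod>i=1..d. N i) < p" by (simp only: of_nat_less_iff)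
  then have cP: "card (\<Pi>\<^sub>E i\<in>{1..d}. {0..<N i}) < card {0..<int p}" by (simp add: card_PiE)
  have "f ` {0..<int p} \<subseteq> (\<Pi>\<^sub>E i\<in>{1..d}. {0..<N i})"
  proof (intro image_subsetI PiE_I)
    fix t i assume i: "i \<in> {1..d}"
    have "nat ((t * u i) mod int p) \<le> p - 1"
      using p pos_mod_bound[of "int p" "t * u i"] by linarith
    then show "f t i \<in> {0..<N i}" using i by (simp add: f_def N_def div_le_mono less_Suc_eq_le)
  qed (simp add: f_def del: atLeastAtMost_iff)
  then have "card (f ` {0..<int p}) < card {0..<int p}"
    using cP card_mono[of "\<Pi>\<^sub>E i\<in>{1..d}. {0..<N i}"] by (meson finite_PiE finite_atLeastAtMost finite_atLeastLessThan le_less_trans)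
  then have "\<not> inj_on f {0..<int p}" by (rule pigeonhole)
  then obtain a b where "a \<in> {0..<int p}" "b \<in> {0..<int p}" "f a = f b" "a \<noteq> b" by (auto simp: inj_on_def)
  then obtain t1 t2 where t: "t1 \<in> {0..<int p}" "t2 \<in> {0..<int p}" "f t1 = f t2" "t2 < t1"
    by (metis linorder_neqE)
  define w where "w i = (t1 * u i) mod int p - (t2 * u i) mod int p" for i
  have wm: "\<bar>of_int (w i)\<bar> * \<mu> i \<le> 1 / real d" if i: "i \<in> {1..d}" for i
  proof -
    define x where "x = nat ((t1 * u i) mod int p)"
    define y where "y = nat ((t2 * u i) mod int p)"
    have "x div h i = y div h i" using fun_cong[OF t(3), of i] i by (simp add: f_def x_def y_def)
    then have "x = h i * (x div h i) + x mod h i" "y = h i * (x div h i) + y mod h i"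
      by (metis mult_div_mod_eq)+
    then have "x + y mod h i = y + x mod h i" by linarith
    moreover have "x mod h i < h i" "y mod h i < h i" by (simp_all add: h_def)
    ultimately have "\<bar>int x - int y\<bar> < int (h i)" by linarith
    moreover have "w i = int x - int y" using p by (simp add: w_def x_def y_def)
    ultimately have "\<bar>w i\<bar> \<le> int (nat \<lfloor>1 / (real d * \<mu> i)\<rfloor>)" by (simp add: h_def)
    also have "\<dots> = \<lfloor>1 / (real d * \<mu> i)\<rfloor>" using \<mu>[OF i] by simp
    finally have "of_int \<bar>w i\<bar> \<le> 1 / (real d * \<mu> i)" by (simp only: le_floor_iff)
    then have "of_int \<bar>w i\<bar> * \<mu> i \<le> 1 / (real d * \<mu> i) * \<mu> i" using \<mu>[OF i] by (intro mult_right_mono) auto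
    also have "\<dots> = 1 / real d" using \<mu>[OF i] by simp
    finally show ?thesis by simp
  qed
  show ?thesis
  proof
    show "0 < t1 - t2" "t1 - t2 < int p" using t by auto
    show "[w i = (t1 - t2) * u i] (mod int p)" for i
      by (simp add: w_def cong_def left_diff_distrib mod_diff_eq)
    have "(\<Sum>i=1..d. \<bar>of_int (w i)\<bar> * \<mu> i) \<le> (\<Sum>i=1..d. 1 / real d)" by (intro sum_mono wm)
    then show "(\<Sum>i=1..d. \<bar>of_int (w i)\<bar> * \<mu> i) \<le> 1" using d by simp
  qed
qed

text \<open>By monotonicity the factors exceeding 1 are exactly those from some index
  \<open>j\<close> on, so the product is \<open>(3 * d * p) ^ (d - j + 1)\<close> times
  \<open>l j \<cdots> l d\<close>. The bound on \<open>\<beta>\<close> controls this with one power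
  of \<open>3 * d * p\<close> fewer.\<close>

lemma prod_max_one_less:
  fixes l :: "nat \<Rightarrow> real" and p \<beta> :: real
  assumes d: "1 \<le> d" and mono: "\<And>i j. 1 \<le> i \<Longrightarrow> i \<le> j \<Longrightarrow> j \<le> d \<Longrightarrow> l i \<le> l j"
    and l: "\<And>i. i \<in> {1..d} \<Longrightarrow> 0 < l i" and ld: "3 * real d * l d < 1"
    and \<beta>: "\<And>j. 1 \<le> j \<Longrightarrow> j < d \<Longrightarrow> \<beta> ^ (d - j) * (\<Prod>i=j..d. l i) \<le> 1"
    and p: "1 < p" "18 * real d ^ 2 * p \<le> \<beta>"
  shows "(\<Prod>i=1..d. max 1 (3 * real d * p * l i)) < p"
proof (cases "\<exists>j. j \<in> {1..d} \<and> 1 < 3 * real d * p * l j")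
  case False
  then have "(\<Prod>i=1..d. max 1 (3 * real d * p * l i)) = (\<Prod>i=1..d. 1)"
    by (intro prod.cong refl) (auto simp: max_def not_less)
  then show ?thesis using p by simp
next
  case True
  define j where "j = (LEAST j. j \<in> {1..d} \<and> 1 < 3 * real d * p * l j)"
  have j: "j \<in> {1..d}" "1 < 3 * real d * p * l j" using LeastI_ex[OF True] by (auto simp: j_def)
  have small: "3 * real d * p * l i \<le> 1" if "i \<in> {1..<j}" for i
    using not_less_Least[of i "\<lambda>j. j \<in> {1..d} \<and> 1 < 3 * real d * p * l j"] that j unfolding j_def[symmetric] by auto
  define m where "m = d - j"
  have "{1..d} = {1..<j} \<union> {j..d}" using j by auto
  then have "(\<Prod>i=1..d. max 1 (3 * real d * p * l i)) =
      (\<Prod>i\<in>{1..<j}. max 1 (3 * real d * p * l i)) * (\<Prod>i=j..d. max 1 (3 * real d * p * l i))"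
    by (simp only:) (intro prod.union_disjoint; auto)
  also have "(\<Prod>i\<in>{1..<j}. max 1 (3 * real d * p * l i)) = (\<Prod>i\<in>{1..<j}. 1)"
    using small by (intro prod.cong refl max_absorb1) blast
  also have "(\<Prod>i=j..d. max 1 (3 * real d * p * l i)) = (\<Prod>i=j..d. 3 * real d * p * l i)"
  proof (intro prod.cong refl)
    fix i assume "i \<in> {j..d}"
    then have "3 * real d * p * l j \<le> 3 * real d * p * l i" using j p by (intro mult_left_mono mono) auto
    then show "max 1 (3 * real d * p * l i) = 3 * real d * p * l i" using j(2) by linarith
  qed
  also have "\<dots> = (3 * real d * p) ^ Suc m * (\<Prod>i=j..d. l i)"
    using j by (simp add: prod.distrib m_def Suc_diff_le del: power_Suc)
  finally have eq: "(\<Prod>i=1..d. max 1 (3 * real d * p * l i)) = (3 * real d * p) ^ Suc m * (\<Prod>i=j..d. l i)" by simp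
  show ?thesis
  proof (cases "j = d")
    \<comment> \<open>Nothing is assumed about \<open>\<beta>\<close> for \<open>j = d\<close>; here
      the smallness of \<open>l d\<close> is what bounds the single factor.\<close>
    case True
    have "p * (3 * real d * l d) < p * 1" using ld p by (intro mult_strict_left_mono) auto
    then show ?thesis unfolding eq by (simp add: True m_def mult_ac)
  next
    case False
    then have "j < d" using j by auto
    then have m: "1 \<le> m" by (simp add: m_def)
    \<comment> \<open>\<open>b\<close> is \<open>3 * d * p\<close> times a spare factor
      \<open>6 * d\<close>. As \<open>m \<ge> 1\<close>, one spare factor is available to offset the
      \<open>3 * d\<close> of the extra power, leaving at most \<open>p / 2\<close>.\<close>
    define b where "b = 18 * real d ^ 2 * p"
    have b0: "0 < b" using d p by (simp add: b_def)
    have pl: "0 \<le> (\<Prod>i=j..d. l i)" using l j by (intro prod_nonneg) (auto intro: less_imp_le)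
    have d6: "1 \<le> 6 * real d" using d by simp
    have "b ^ m * (\<Prod>i=j..d. l i) \<le> \<beta> ^ m * (\<Prod>i=j..d. l i)"
      using p b0 pl unfolding b_def by (intro mult_right_mono power_mono) auto
    also have "\<dots> \<le> 1" using \<beta>[of j] j False by (simp add: m_def)
    finally have bl: "b ^ m * (\<Prod>i=j..d. l i) \<le> 1" .
    have "b = 6 * real d * (3 * real d * p)" by (simp add: b_def power2_eq_square)
    then have bm: "b ^ m = (6 * real d) ^ m * (3 * real d * p) ^ m" by (simp only: power_mult_distrib[symmetric])
    have "6 * real d \<le> (6 * real d) ^ m" using m d6 by (metis power_increasing power_one_right)
    then have "6 * real d * ((3 * real d * p) ^ m * (\<Prod>i=j..d. l i))
        \<le> (6 * real d) ^ m * ((3 * real d * p) ^ m * (\<Prod>i=j..d. l i))"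
      using pl p by (intro mult_right_mono) auto
    also have "\<dots> \<le> 1" using bl by (simp add: bm mult.assoc)
    finally have "p * (6 * real d * ((3 * real d * p) ^ m * (\<Prod>i=j..d. l i))) \<le> p * 1"
      using p by (intro mult_left_mono) auto
    then have "2 * (\<Prod>i=1..d. max 1 (3 * real d * p * l i)) \<le> p" unfolding eq by (simp add: mult_ac)
    then show ?thesis using p by linarith
  qed
qed

section \<open>Successive minima\<close>

lemma sym_convex_body_facts:
  fixes K :: "(real^'n) set"
  assumes "sym_convex_body K"
  shows "convex K" "\<And>x. x \<in> K \<Longrightarrow> - x \<in> K" "\<exists>e>0. ball 0 e \<subseteq> K"
proof -
  show c: "convex K" and s: "\<And>x. x \<in> K \<Longrightarrow> - x \<in> K"
    using assms unfolding sym_convex_body_def by blast+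
  obtain x e where e: "0 < e" "ball x e \<subseteq> K"
    using assms unfolding sym_convex_body_def by (metis all_not_in_conv mem_interior)
  have "ball 0 e \<subseteq> K"
  proof
    fix y :: "real^'n" assume "y \<in> ball 0 e"
    \<comment> \<open>\<open>y\<close> is the midpoint of \<open>x + y\<close> and of the reflection
      of \<open>x - y\<close>.\<close>
    then have "x + y \<in> ball x e" "x - y \<in> ball x e" by (simp_all add: dist_norm)
    then have "x + y \<in> K" "- (x - y) \<in> K" using e s by blast+
    then have "(1/2) *\<^sub>R (x + y) + (1/2) *\<^sub>R (- (x - y)) \<in> K" using c by (intro convexD) auto
    moreover have "(1/2) *\<^sub>R (x + y) + (1/2) *\<^sub>R (- (x - y)) = y"
      unfolding scaleR_add_right[symmetric] by (simp add: scaleR_half_double[of y, simplified])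
    ultimately show "y \<in> K" by simp
  qed
  with e show "\<exists>e>0. ball 0 e \<subseteq> K" by blast
qed

lemma lattice_sum_mem:
  assumes "is_lattice L" "finite I" "\<And>i. i \<in> I \<Longrightarrow> v i \<in> L"
  shows "(\<Sum>i\<in>I. of_int (w i) *\<^sub>R v i) \<in> L"
proof -
  obtain b :: "'a \<Rightarrow> real^'a" where L: "L = range (\<lambda>z :: 'a \<Rightarrow> int. \<Sum>i\<in>UNIV. of_int (z i) *\<^sub>R b i)"
    using assms(1) unfolding is_lattice_def by blast
  have "\<forall>i\<in>I. \<exists>z :: 'a \<Rightarrow> int. v i = (\<Sum>m\<in>UNIV. of_int (z m) *\<^sub>R b m)" using assms(3) L by blast
  then obtain z :: "_ \<Rightarrow> 'a \<Rightarrow> int" where z: "\<And>i. i \<in> I \<Longrightarrow> v i = (\<Sum>m\<in>UNIV. of_int (z i m) *\<^sub>R b m)"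
    by metis
  have "(\<Sum>i\<in>I. of_int (w i) *\<^sub>R v i) = (\<Sum>i\<in>I. \<Sum>m\<in>UNIV. of_int (w i * z i m) *\<^sub>R b m)"
    by (intro sum.cong refl) (simp add: z scaleR_sum_right)
  also have "\<dots> = (\<Sum>m\<in>UNIV. \<Sum>i\<in>I. of_int (w i * z i m) *\<^sub>R b m)" by (rule sum.swap)
  also have "\<dots> = (\<Sum>m\<in>UNIV. of_int (\<Sum>i\<in>I. w i * z i m) *\<^sub>R b m)"
    by (simp add: scaleR_sum_left)
  finally show ?thesis unfolding L by (rule range_eqI[where x = "\<lambda>m. \<Sum>i\<in>I. w i * z i m"])
qed

lemma zero_mem_lattice: "is_lattice L \<Longrightarrow> 0 \<in> L"
  using lattice_sum_mem[of L "{}"] by simp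

context
  fixes L K :: "(real^'n) set"
  assumes L: "is_lattice L" and K: "sym_convex_body K"
begin

lemma zero_mem_body: "0 \<in> K"
  using sym_convex_body_facts(3)[OF K] by (metis centre_in_ball subsetD)

text \<open>Lattice and dilates contain the origin, so the affine dimension in
  \<open>succ_min\<close> can be replaced by the linear one, as is done in
  \<open>dilates\<close>.\<close>

lemma aff_dim_dilate:
  "aff_dim (L \<inter> (\<lambda>x. l *\<^sub>R x) ` K) = int (dim (L \<inter> (\<lambda>x. l *\<^sub>R x) ` K))"
proof (rule aff_dim_zero)
  have "0 \<in> L \<inter> (\<lambda>x. l *\<^sub>R x) ` K" using zero_mem_lattice[OF L] zero_mem_body by (auto intro: image_eqI[of _ _ 0])
  then show "0 \<in> affine hull (L \<inter> (\<lambda>x. l *\<^sub>R x) ` K)" by (rule hull_inc)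
qed

definition dilates :: "nat \<Rightarrow> real set" where
  "dilates i = {l. 0 < l \<and> i \<le> dim (L \<inter> (\<lambda>x. l *\<^sub>R x) ` K)}"

lemma succ_min_eq: "succ_min L K i = Inf (dilates i)"
  unfolding succ_min_def dilates_def aff_dim_dilate by simp

lemma bdd_dilates: "bdd_below (dilates i)"
  by (rule bdd_belowI[of _ 0]) (simp add: dilates_def)

text \<open>Needed for the infimum to be meaningful. A large dilate of a ball inside
  \<open>K\<close> contains a whole lattice basis.\<close>

lemma dilates_nonempty:
  assumes "i \<le> CARD('n)"
  shows "dilates i \<noteq> {}"
proof -
  obtain b :: "'n \<Rightarrow> real^'n" where b: "inj b" "independent (range b)"
    and Lb: "L = range (\<lambda>z :: 'n \<Rightarrow> int. \<Sum>i\<in>UNIV. of_int (z i) *\<^sub>R b i)"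
    using L unfolding is_lattice_def by blast
  obtain e where e: "0 < e" "ball 0 e \<subseteq> K" using sym_convex_body_facts(3)[OF K] by blast
  define l where "l = (1 + (\<Sum>i\<in>UNIV. norm (b i))) / e"
  have s0: "0 \<le> (\<Sum>i\<in>UNIV. norm (b i))" by (intro sum_nonneg) auto
  have l0: "0 < l" using e s0 by (simp add: l_def add_pos_nonneg)
  have "b m \<in> L \<inter> (\<lambda>x. l *\<^sub>R x) ` K" for m
  proof
    have "b m = (\<Sum>i\<in>UNIV. of_int (if i = m then 1 else 0) *\<^sub>R b i)"
      by (simp add: if_distrib[of of_int] if_distrib[of "\<lambda>x. x *\<^sub>R _"] cong: if_cong)
    then show "b m \<in> L" unfolding Lb by (rule range_eqI[where x = "\<lambda>i. if i = m then 1 else 0"])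
    have "norm (b m) \<le> (\<Sum>i\<in>UNIV. norm (b i))" by (intro member_le_sum) auto
    then have "norm (b m) < l * e" using e by (simp add: l_def)
    then have "(1 / l) *\<^sub>R b m \<in> ball 0 e" using l0 by (simp add: field_simps)
    then show "b m \<in> (\<lambda>x. l *\<^sub>R x) ` K" using e l0 by (intro image_eqI[of _ _ "(1 / l) *\<^sub>R b m"]) auto
  qed
  then have "range b \<subseteq> L \<inter> (\<lambda>x. l *\<^sub>R x) ` K" by blast
  then have "card (range b) \<le> dim (L \<inter> (\<lambda>x. l *\<^sub>R x) ` K)"
    using independent_card_le_dim b(2) by blast
  then have "CARD('n) \<le> dim (L \<inter> (\<lambda>x. l *\<^sub>R x) ` K)" using card_image[OF b(1)] by simp
  then show ?thesis using l0 assms by (auto simp: dilates_def)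
qed

lemma succ_min_nonneg: "i \<le> CARD('n) \<Longrightarrow> 0 \<le> succ_min L K i"
  unfolding succ_min_eq using dilates_nonempty by (intro cInf_greatest) (auto simp: dilates_def)

lemma succ_min_mono: "i \<le> j \<Longrightarrow> j \<le> CARD('n) \<Longrightarrow> succ_min L K i \<le> succ_min L K j"
  unfolding succ_min_eq using dilates_nonempty bdd_dilates
  by (intro cInf_superset_mono) (auto simp: dilates_def)

text \<open>Some admissible \<open>l\<close> lies strictly below \<open>\<mu>\<close>, and dilates
  of a convex set containing 0 are nested. Taking \<open>\<mu>\<close> above the minimum avoids
  proving that the infimum is attained.\<close>

lemma le_dim_dilate:
  assumes "i \<le> CARD('n)" "succ_min L K i < \<mu>"
  shows "i \<le> dim (L \<inter> (\<lambda>x. \<mu> *\<^sub>R x) ` K)"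
proof -
  obtain l where l: "l \<in> dilates i" "l < \<mu>"
    using assms dilates_nonempty cInf_lessD unfolding succ_min_eq by blast
  then have l0: "0 < l" "i \<le> dim (L \<inter> (\<lambda>x. l *\<^sub>R x) ` K)" by (auto simp: dilates_def)
  have "(\<lambda>x. l *\<^sub>R x) ` K \<subseteq> (\<lambda>x. \<mu> *\<^sub>R x) ` K"
  proof (rule image_subsetI)
    fix x assume x: "x \<in> K"
    have "(l / \<mu>) *\<^sub>R x + (1 - l / \<mu>) *\<^sub>R 0 \<in> K"
      using sym_convex_body_facts(1)[OF K] x zero_mem_body l l0 by (intro convexD) auto
    then show "l *\<^sub>R x \<in> (\<lambda>x. \<mu> *\<^sub>R x) ` K"
      using l l0 by (intro image_eqI[of _ _ "(l / \<mu>) *\<^sub>R x"]) auto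
  qed
  then have "dim (L \<inter> (\<lambda>x. l *\<^sub>R x) ` K) \<le> dim (L \<inter> (\<lambda>x. \<mu> *\<^sub>R x) ` K)"
    by (intro dim_subset) blast
  with l0 show ?thesis by simp
qed

end

section \<open>Inequalities between the parameter beta and the successive minima\<close>

lemma beta_param_nonneg:
  assumes "2 \<le> CARD('n)"
  shows "0 \<le> beta_param L (K :: (real^'n) set)"
  unfolding beta_param_def using assms by (subst Min_ge_iff) auto

lemma beta_param_le:
  fixes K :: "(real^'n) set"
  assumes "1 \<le> j" "j < CARD('n)"
  shows "beta_param L K \<le> (\<Prod>i=j..CARD('n). succ_min L K i) powr (- 1 / (real CARD('n) - real j))"
  unfolding beta_param_def using assms by (intro Min_le) auto

lemma beta_param_power_le:
  fixes L K :: "(real^'n) set"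
  assumes L: "is_lattice L" and K: "sym_convex_body K" and j: "1 \<le> j" "j < CARD('n)"
  shows "beta_param L K ^ (CARD('n) - j) * (\<Prod>i=j..CARD('n). succ_min L K i) \<le> 1"
proof -
  define m where "m = CARD('n) - j"
  define P where "P = (\<Prod>i=j..CARD('n). succ_min L K i)"
  have m: "0 < m" "real CARD('n) - real j = real m" using j by (auto simp: m_def of_nat_diff)
  have P0: "0 \<le> P" unfolding P_def using succ_min_nonneg[OF L K] by (intro prod_nonneg) auto
  show ?thesis
  proof (cases "P = 0")
    \<comment> \<open>Here \<open>P powr (- 1 / m)\<close> is 0 by convention instead of infinite,
      so the case is separated; the claim is trivial.\<close>
    case True
    then show ?thesis unfolding P_def by (simp only: mult_zero_right zero_le_one)
  next
    case False
    have "beta_param L K ^ m \<le> (P powr (- 1 / real m)) ^ m"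
      using beta_param_le[OF j, of L K] beta_param_nonneg[of L K] j unfolding m(2) P_def[symmetric]
      by (intro power_mono) auto
    also have "\<dots> = P powr (- 1)"
      using m P0 False by (simp add: powr_realpow[symmetric] powr_powr)
    finally have "beta_param L K ^ m * P \<le> P powr (- 1) * P" using P0 by (intro mult_right_mono)
    also have "\<dots> = 1" using P0 False by (simp add: powr_minus)
    finally show ?thesis by (simp add: m_def P_def)
  qed
qed

text \<open>For \<open>j = 1\<close> all minima enter the product. If one vanished,
  \<open>0 powr _ = 0\<close> would make \<open>beta_param\<close> at most 0. This takes the place
  of an argument from the discreteness of the lattice.\<close>

lemma succ_min_pos:
  fixes L K :: "(real^'n) set"
  assumes L: "is_lattice L" and K: "sym_convex_body K" and d: "2 \<le> CARD('n)"
    and \<beta>: "0 < beta_param L K" and i: "1 \<le> i" "i \<le> CARD('n)"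
  shows "0 < succ_min L K i"
proof -
  have "0 < (\<Prod>i=1..CARD('n). succ_min L K i) powr (- 1 / (real CARD('n) - real 1))"
    using beta_param_le[of 1 L K] \<beta> d by linarith
  then have "(\<Prod>i=1..CARD('n). succ_min L K i) \<noteq> 0" by auto
  then have "succ_min L K i \<noteq> 0" using i by auto
  then show ?thesis using succ_min_nonneg[OF L K i(2)] by simp
qed

section \<open>Lifting residue vectors to lattice points\<close>

text \<open>The vectors \<open>v\<close> are fixed before \<open>u\<close>. A combination lies in
  \<open>K\<close> as soon as its coefficients weighted by \<open>\<mu>\<close> have absolute sum at
  most 1. The two ways to achieve this are separated by the threshold \<open>1 / (3 * d)\<close> for
  \<open>l d\<close>.\<close>

lemma exists_short_multiples_in_body:
  fixes L K :: "(real^'n) set"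
  defines "d \<equiv> CARD('n)"
  defines "l \<equiv> succ_min L K"
  assumes L: "is_lattice L" and K: "sym_convex_body K" and d: "2 \<le> d" and ld: "l d \<le> 1"
    and p: "1 < p" "18 * real d ^ 2 * real p \<le> (1 - l d) * beta_param L K"
  shows "\<exists>v. (\<forall>i\<in>{1..d}. v i \<in> L \<and> v i \<notin> span (v ` {1..<i})) \<and>
    (\<forall>u\<in>residue_chart p d. \<exists>t w. 0 < t \<and> t < int p \<and> (\<forall>i\<in>{1..d}. [w i = t * u i] (mod int p)) \<and>
      (\<Sum>i=1..d. of_int (w i) *\<^sub>R v i) \<in> K)"
proof -
  define \<beta> where "\<beta> = beta_param L K"
  have \<beta>0: "0 \<le> \<beta>" using beta_param_nonneg d by (auto simp: \<beta>_def d_def)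
  have "0 < (1 - l d) * \<beta>" using p d unfolding \<beta>_def by (intro less_le_trans[OF _ p(2)]) auto
  then have \<beta>: "0 < \<beta>" and ld1: "l d < 1" using \<beta>0 ld by (auto simp: zero_less_mult_iff)
  have l0: "0 < l i" if "i \<in> {1..d}" for i
    using succ_min_pos[OF L K] d \<beta> that by (auto simp: \<beta>_def d_def l_def)
  have lmono: "l i \<le> l j" if "i \<le> j" "j \<le> d" for i j
    using succ_min_mono[OF L K] that by (auto simp: d_def l_def)
  have \<beta>pow: "\<beta> ^ (d - j) * (\<Prod>i=j..d. l i) \<le> 1" if "1 \<le> j" "j < d" for j
    using beta_param_power_le[OF L K] that by (auto simp: d_def l_def \<beta>_def)
  \<comment> \<open>Half of the gap \<open>1 - l d\<close> is spent on enlarging the minima. As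
    \<open>\<eta> \<le> 1 / 2\<close>, the factor \<open>2 * d\<close> of the pigeonhole lemma
    becomes \<open>3 * d\<close> in terms of \<open>l\<close>.\<close>
  define \<eta> where "\<eta> = (1 - l d) / 2"
  have \<eta>: "0 < \<eta>" "\<eta> \<le> 1 / 2" using ld1 l0[of d] d by (auto simp: \<eta>_def)
  define \<mu> where "\<mu> i = (1 + \<eta>) * l i" for i
  have \<mu>: "0 < \<mu> i" "l i < \<mu> i" "\<mu> i \<le> 3 / 2 * l i" if "i \<in> {1..d}" for i
    using \<eta> l0[OF that] by (auto simp: \<mu>_def intro!: mult_right_mono)
  have "i \<le> dim (L \<inter> (\<lambda>x. \<mu> i *\<^sub>R x) ` K)" if "i \<in> {1..d}" for i
    using le_dim_dilate[OF L K] \<mu>(2)[OF that] that by (auto simp: l_def d_def)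
  from exists_independent_sequence[where A = "\<lambda>i. L \<inter> (\<lambda>x. \<mu> i *\<^sub>R x) ` K", OF this]
  obtain v where v: "\<And>i. i \<in> {1..d} \<Longrightarrow> v i \<in> L" "\<And>i. i \<in> {1..d} \<Longrightarrow> v i \<in> (\<lambda>x. \<mu> i *\<^sub>R x) ` K"
    "\<And>i. i \<in> {1..d} \<Longrightarrow> v i \<notin> span (v ` {1..<i})" by blast
  have "\<forall>i\<in>{1..d}. \<exists>x\<in>K. v i = \<mu> i *\<^sub>R x" using v(2) by blast
  then obtain x where x: "\<And>i. i \<in> {1..d} \<Longrightarrow> x i \<in> K \<and> v i = \<mu> i *\<^sub>R x i" by metis
  have inK: "(\<Sum>i=1..d. of_int (w i) *\<^sub>R v i) \<in> K"
    if w: "(\<Sum>i=1..d. \<bar>of_int (w i)\<bar> * \<mu> i) \<le> 1" for w :: "nat \<Rightarrow> int"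
  proof -
    have "0 \<in> K" using sym_convex_body_facts(3)[OF K] by (metis centre_in_ball subsetD)
    moreover have "(\<Sum>i=1..d. \<bar>of_int (w i) * \<mu> i\<bar>) \<le> 1"
      using w \<mu>(1) by (simp add: abs_mult less_imp_le)
    ultimately have "(\<Sum>i=1..d. (of_int (w i) * \<mu> i) *\<^sub>R x i) \<in> K"
      using sym_convex_body_facts(1,2)[OF K] x by (intro sum_scaleR_mem_symmetric_convex) auto
    then show ?thesis using x by simp
  qed
  have "\<exists>t w. 0 < t \<and> t < int p \<and> (\<forall>i\<in>{1..d}. [w i = t * u i] (mod int p)) \<and>
      (\<Sum>i=1..d. of_int (w i) *\<^sub>R v i) \<in> K" if u: "u \<in> residue_chart p d" for u
  proof (cases "3 * real d * l d < 1")
    case True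
    have "(\<Prod>i=1..d. max 1 (2 * real d * real p * \<mu> i)) \<le> (\<Prod>i=1..d. max 1 (3 * real d * real p * l i))"
    proof (intro prod_mono conjI max.mono order_refl)
      fix i assume i: "i \<in> {1..d}"
      have "2 * real d * real p * \<mu> i \<le> 2 * real d * real p * (3 / 2 * l i)"
        using \<mu>(3)[OF i] by (intro mult_left_mono) auto
      then show "2 * real d * real p * \<mu> i \<le> 3 * real d * real p * l i" by simp
    qed auto
    also have "\<dots> < real p"
    proof (rule prod_max_one_less[where \<beta> = \<beta>])
      have "(1 - l d) * \<beta> \<le> 1 * \<beta>" using \<beta> l0[of d] d by (intro mult_right_mono) auto
      then show "18 * real d ^ 2 * real p \<le> \<beta>" using p by (simp add: \<beta>_def)
    qed (use d p True l0 lmono \<beta>pow in auto)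
    finally have less: "(\<Prod>i=1..d. max 1 (2 * real d * real p * \<mu> i)) < real p" .
    have "1 \<le> d" using d by simp
    from exists_short_multiple_mod[where u = u, OF p(1) this \<mu>(1) less]
    obtain t w where "0 < t" "t < int p" "\<And>i. i \<in> {1..d} \<Longrightarrow> [w i = t * u i] (mod int p)"
      "(\<Sum>i=1..d. \<bar>of_int (w i)\<bar> * \<mu> i) \<le> 1"
      by blast
    then show ?thesis using inK by blast
  next
    case False
    \<comment> \<open>The index \<open>j = d - 1\<close> in \<open>beta_param\<close> gives
      \<open>\<beta> * q * l d \<le> 1\<close>. Since \<open>l d\<close> is at least
      \<open>1 / (3 * d)\<close>, this makes \<open>p * q\<close> small compared with
      \<open>1 - l d\<close>, so the coordinates below \<open>d\<close> may be any residues.\<close>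
    define q where "q = l (d - 1)"
    have q0: "0 < q" using l0[of "d - 1"] d by (auto simp: q_def)
    have "{d - 1..d} = {d - 1, d}" using d by auto
    then have "\<beta> * (q * l d) \<le> 1" using \<beta>pow[of "d - 1"] d by (simp add: q_def)
    have "18 * real d ^ 2 * (real p * q) * l d \<le> (1 - l d) * \<beta> * (q * l d)"
      using mult_right_mono[OF p(2), of "q * l d"] q0 l0[of d] d by (simp add: \<beta>_def mult_ac)
    also have "\<dots> \<le> (1 - l d) * 1"
      using \<open>\<beta> * (q * l d) \<le> 1\<close> ld1 unfolding mult.assoc by (intro mult_left_mono) auto
    finally have 1: "18 * real d ^ 2 * (real p * q) * l d \<le> 1 - l d" by simp
    have "6 * real d * (real p * q) * 1 \<le> 6 * real d * (real p * q) * (3 * real d * l d)"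
      using False q0 by (intro mult_left_mono) auto
    also have "\<dots> = 18 * real d ^ 2 * (real p * q) * l d" by (simp add: power2_eq_square)
    finally have pq: "6 * real d * (real p * q) \<le> 1 - l d" using 1 by linarith
    have ud: "u d = 1" and ui: "\<And>i. i \<in> {1..d} \<Longrightarrow> 0 \<le> u i \<and> u i < int p"
      using u by (auto simp: residue_chart_def PiE_iff)
    have "{1..d} = insert d {1..<d}" using d by auto
    then have "(\<Sum>i=1..d. \<bar>of_int (u i)\<bar> * \<mu> i) = \<mu> d + (\<Sum>i\<in>{1..<d}. \<bar>of_int (u i)\<bar> * \<mu> i)"
      by (simp add: ud)
    also have "(\<Sum>i\<in>{1..<d}. \<bar>of_int (u i)\<bar> * \<mu> i) \<le> (\<Sum>i\<in>{1..<d}. real p * (3 / 2 * q))"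
    proof (intro sum_mono mult_mono)
      fix i assume i: "i \<in> {1..<d}"
      then show "\<bar>of_int (u i)\<bar> \<le> real p" using ui[of i] by simp
      have "\<mu> i \<le> 3 / 2 * l i" using \<mu>(3)[of i] i by simp
      also have "l i \<le> q" unfolding q_def using i by (intro lmono) auto
      finally show "\<mu> i \<le> 3 / 2 * q" by simp
      show "0 \<le> \<mu> i" using \<mu>(1)[of i] i by simp
    qed simp
    also have "\<dots> = real (d - 1) * (3 / 2 * (real p * q))" by simp
    also have "\<dots> \<le> real d * (3 / 2 * (real p * q))" using q0 by (intro mult_right_mono) auto
    also have "\<dots> = 6 * real d * (real p * q) / 4" by simp
    also have "\<dots> \<le> (1 - l d) / 4" using pq by (rule divide_right_mono) simp
    \<comment> \<open>The last coordinate uses \<open>l d\<close> plus half of the gap, and the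
      others together at most a quarter of it.\<close>
    also have "\<mu> d \<le> l d + \<eta>" using \<eta> ld1 l0[of d] d mult_left_mono[of "l d" 1 \<eta>] by (simp add: \<mu>_def distrib_right)
    also have "l d + \<eta> + (1 - l d) / 4 \<le> 1" using ld1 unfolding \<eta>_def by (simp add: field_simps)
    finally have "(\<Sum>i=1..d. \<bar>of_int (u i)\<bar> * \<mu> i) \<le> 1" by simp
    then show ?thesis using inK[of u] p by (intro exI[of _ 1] exI[of _ u]) auto
  qed
  then show ?thesis using v by blast
qed

text \<open>Integer points of \<open>V\<close> are integer combinations of \<open>k\<close>
  generators. Reducing modulo \<open>p\<close> and dividing by the multiplier \<open>t\<close>,
  which is invertible because \<open>p\<close> is prime, puts the original residue vectors into one
  \<open>residue_combinations\<close> set.\<close>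

lemma exists_points_few_on_subspaces:
  fixes v :: "nat \<Rightarrow> 'a::euclidean_space"
  assumes p: "prime p" and d: "1 \<le> d"
    and v: "\<And>i. i \<in> {1..d} \<Longrightarrow> v i \<notin> span (v ` {1..<i})"
    and R: "R \<subseteq> residue_chart p d"
    and short: "\<And>u. u \<in> R \<Longrightarrow> \<exists>t w. 0 < t \<and> t < int p \<and> (\<forall>i\<in>{1..d}. [w i = t * u i] (mod int p)) \<and>
      (\<Sum>i=1..d. of_int (w i) *\<^sub>R v i) \<in> T"
    and few: "\<And>g. card (R \<inter> residue_combinations p d k g) \<le> n"
  shows "\<exists>S\<subseteq>T. card S = card R \<and> (\<forall>V. subspace V \<and> dim V = k \<longrightarrow> card (S \<inter> V) \<le> n)"
proof -
  let ?\<phi> = "\<lambda>w. \<Sum>i=1..d. of_int (w i) *\<^sub>R v i"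
  obtain t w where t: "\<And>u. u \<in> R \<Longrightarrow> 0 < t u \<and> t u < int p"
    and w: "\<And>u i. u \<in> R \<Longrightarrow> i \<in> {1..d} \<Longrightarrow> [w u i = t u * u i] (mod int p)"
    and T: "\<And>u. u \<in> R \<Longrightarrow> ?\<phi> (w u) \<in> T" using short by metis
  have diff: "?\<phi> (\<lambda>i. x i - m * y i) = ?\<phi> x - of_int m *\<^sub>R ?\<phi> y" for x y :: "nat \<Rightarrow> int" and m
    by (simp add: scaleR_diff_left sum_subtractf scaleR_sum_right)
  have combos: "\<exists>g :: nat \<Rightarrow> nat \<Rightarrow> int. \<forall>w. ?\<phi> w \<in> V \<longrightarrow> (\<exists>c. \<forall>i\<in>{1..d}. w i = (\<Sum>j<k. c j * g j i))"
    if V: "subspace V" "dim V = k" for V k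
  proof -
    let ?G = "{w :: nat \<Rightarrow> int. ?\<phi> w \<in> V}"
    have "dim (?\<phi> ` ?G) \<le> k" using dim_subset[of "?\<phi> ` ?G" V] V by auto
    moreover have "(\<lambda>i. x i - m * y i) \<in> ?G" if "x \<in> ?G" "y \<in> ?G" for x y m
      using that V unfolding mem_Collect_eq diff by (simp add: subspace_diff subspace_scale)
    ultimately show ?thesis using integer_points_subset_combinations[of d v ?G k, OF v] by auto
  qed
  have cop: "coprime (t u) (int p)" if "u \<in> R" for u
  proof -
    have "\<not> int p dvd t u" using t[OF that] zdvd_not_zless by blast
    then have "coprime (int p) (t u)" using p by (intro prime_imp_coprime) simp_all
    then show ?thesis by (simp only: coprime_commute)
  qed
  have inj: "inj_on (\<lambda>u. ?\<phi> (w u)) R"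
  proof (rule inj_onI)
    fix u u' assume u: "u \<in> R" "u' \<in> R" and eq: "?\<phi> (w u) = ?\<phi> (w u')"
    \<comment> \<open>For \<open>V = {0}\<close> there are no generators, so all coordinates of the
      difference are empty sums: this is the uniqueness of coordinates along
      \<open>v\<close>.\<close>
    have zero: "?\<phi> (\<lambda>i. w u i - 1 * w u' i) \<in> {0}" unfolding diff eq by simp
    have ww: "w u i = w u' i" if i: "i \<in> {1..d}" for i
    proof -
      have "\<exists>c. \<forall>i\<in>{1..d}. w u i - 1 * w u' i = (\<Sum>j<(0::nat). c j * g j i)"
        if "\<forall>w. ?\<phi> w \<in> {0} \<longrightarrow> (\<exists>c. \<forall>i\<in>{1..d}. w i = (\<Sum>j<0. c j * g j i))" for g :: "nat \<Rightarrow> nat \<Rightarrow> int"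
        using that[rule_format, OF zero] .
      then show ?thesis using combos[of "{0}" 0] i by auto
    qed
    have one: "u d = 1" "u' d = 1" using u R by (auto simp: residue_chart_def)
    \<comment> \<open>Coordinate \<open>d\<close> of a lift is the multiplier modulo
      \<open>p\<close>, so equal lifts have equal multipliers, which can then be cancelled.\<close>
    have "[t u = t u'] (mod int p)"
      using w[OF u(1), of d] w[OF u(2), of d] ww[of d] d one by (simp add: cong_def)
    then have tt: "t u = t u'" using t[OF u(1)] t[OF u(2)] by (simp add: cong_def)
    have "u i = u' i" if i: "i \<in> {1..d}" for i
    proof -
      have "[t u * u i = t u * u' i] (mod int p)"
        using w[OF u(1) i] w[OF u(2) i] ww[OF i] tt by (simp add: cong_def)
      then have "[u i = u' i] (mod int p)" using cop[OF u(1)] by (simp add: cong_mult_lcancel)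
      moreover have "u i \<in> {0..<int p}" "u' i \<in> {0..<int p}"
        using u R i unfolding residue_chart_def by (blast dest: PiE_mem)+
      ultimately show ?thesis by (simp add: cong_def)
    qed
    then show "u = u'" using u R by (intro PiE_ext[of u "{1..d}" _ u']) (auto simp: residue_chart_def)
  qed
  have "finite ({1..d} \<rightarrow>\<^sub>E {0..<int p})" by (intro finite_PiE) auto
  then have finR: "finite R" by (rule finite_subset[rotated]) (use R in \<open>auto simp: residue_chart_def\<close>)
  define S where "S = (\<lambda>u. ?\<phi> (w u)) ` R"
  have "card (S \<inter> V) \<le> n" if V: "subspace V" "dim V = k" for V
  proof -
    obtain g :: "nat \<Rightarrow> nat \<Rightarrow> int"
      where g: "\<And>w. ?\<phi> w \<in> V \<Longrightarrow> \<exists>c. \<forall>i\<in>{1..d}. w i = (\<Sum>j<k. c j * g j i)"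
      using combos[OF V] by blast
    have "S \<inter> V \<subseteq> (\<lambda>u. ?\<phi> (w u)) ` (R \<inter> residue_combinations p d k g)"
    proof
      fix y assume "y \<in> S \<inter> V"
      then obtain u where u: "u \<in> R" "y = ?\<phi> (w u)" "?\<phi> (w u) \<in> V" by (auto simp: S_def)
      obtain c where c: "\<And>i. i \<in> {1..d} \<Longrightarrow> w u i = (\<Sum>j<k. c j * g j i)" using g[OF u(3)] by blast
      obtain a where a: "[t u * a = 1] (mod int p)" using cong_solve_coprime_int[OF cop[OF u(1)]] by blast
      have "[u i = (\<Sum>j<k. (a * c j) * g j i)] (mod int p)" if i: "i \<in> {1..d}" for i
      proof -
        have "[t u * a * u i = 1 * u i] (mod int p)" using a by (intro cong_mult cong_refl)
        moreover have "[a * w u i = a * (t u * u i)] (mod int p)" using w[OF u(1) i] by (intro cong_mult cong_refl)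
        ultimately have "[u i = a * w u i] (mod int p)" by (simp add: cong_def mult_ac)
        then show ?thesis unfolding c[OF i] by (simp add: sum_distrib_left mult.assoc)
      qed
      moreover have "u \<in> {1..d} \<rightarrow>\<^sub>E {0..<int p}" using u R by (auto simp: residue_chart_def)
      ultimately have "u \<in> residue_combinations p d k g"
        unfolding residue_combinations_def by (intro CollectI conjI exI[of _ "\<lambda>j. a * c j"]) auto
      then show "y \<in> (\<lambda>u. ?\<phi> (w u)) ` (R \<inter> residue_combinations p d k g)" using u by blast
    qed
    then have "card (S \<inter> V) \<le> card (R \<inter> residue_combinations p d k g)"
      using finR by (meson surj_card_le finite_Int)
    then show ?thesis using few[of g] by simp
  qed
  moreover have "S \<subseteq> T" using T by (auto simp: S_def)
  moreover have "card S = card R" unfolding S_def by (rule card_image[OF inj])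
  ultimately show ?thesis by blast
qed

section \<open>Choice of the constants and the final estimate\<close>

theorem theorem4:
  fixes k :: nat and \<epsilon> :: real
  assumes "1 \<le> k" and "k \<le> CARD('n) - 1" and "0 < \<epsilon>" and "\<epsilon> < 1"
  shows "\<exists>r :: nat. 0 < r \<and> (\<exists>c :: real. 0 < c \<and>
    (\<forall>(L :: (real^'n) set) K.
       is_lattice L \<and> sym_convex_body K \<and> succ_min L K CARD('n) \<le> 1 \<longrightarrow>
       (\<exists>S. S \<subseteq> L \<inter> K \<and>
          real (card S) \<ge> c * ((1 - succ_min L K CARD('n)) * beta_param L K)
                              powr (real CARD('n) - real k - \<epsilon>) \<and>
          (\<forall>V. subspace V \<and> dim V = k \<longrightarrow> card (S \<inter> V) \<le> r - 1))))"
proof -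
  define d where "d = CARD('n)"
  have d: "2 \<le> d" "k < d" using assms(1,2) by (auto simp: d_def)
  define e where "e = real d - real k - \<epsilon>"
  \<comment> \<open>Only \<open>\<epsilon> / 2\<close> goes into the random choice. The other half
    covers the loss in the prime: \<open>p\<close> of order \<open>X powr (e / e')\<close> still
    gives \<open>p powr e'\<close> of order \<open>X powr e\<close>.\<close>
  define e' where "e' = real d - real k - \<epsilon> / 2"
  have "real k + 1 \<le> real d" using d by linarith
  then have e: "0 < e" "e < e'" using assms(3,4) by (auto simp: e_def e'_def)
  obtain r where r: "2 \<le> r" and Rex: "\<And>p. 1 < p \<Longrightarrow> \<exists>R \<subseteq> residue_chart p d.
     real p powr e' / (2 * real r) \<le> real (card R) \<and>
     (\<forall>g. card (R \<inter> residue_combinations p d k g) \<le> r - 1)"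
    using exists_subset_residue_chart[of "\<epsilon> / 2" k d] assms d unfolding e'_def by auto
  have \<theta>: "0 < e / e'" "e / e' < 1" using e by auto
  obtain C where C: "0 < C"
    and prime: "\<And>x. 2 \<le> x \<Longrightarrow> \<exists>p. prime p \<and> real p \<le> x \<and> x powr (e / e') \<le> C * real p"
    using prime_below_ge_powr[OF \<theta>] by blast
  define b where "b = 18 * real d ^ 2"
  have b: "0 < b" using d by (simp add: b_def)
  \<comment> \<open>The first entry makes the required size at most 1 when \<open>X < 2 * b\<close>,
    where \<open>{0}\<close> serves as \<open>S\<close> because \<open>r \<ge> 2\<close>. In the
    second, \<open>b\<close> comes from the lifting lemma, \<open>C\<close> from the choice of the
    prime and \<open>2 * r\<close> from the random subset.\<close>
  define c where "c = min (1 / (2 * b) powr e) (1 / (b powr e * C powr e' * (2 * real r)))"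
  have c0: "0 < c" using b C r by (simp add: c_def)
  have "\<exists>S. S \<subseteq> L \<inter> K \<and> c * ((1 - succ_min L K d) * beta_param L K) powr e \<le> real (card S) \<and>
      (\<forall>V. subspace V \<and> dim V = k \<longrightarrow> card (S \<inter> V) \<le> r - 1)"
    if L: "is_lattice L" and K: "sym_convex_body K" and ld: "succ_min L K d \<le> 1" for L K :: "(real^'n) set"
  proof -
    define X where "X = (1 - succ_min L K d) * beta_param L K"
    have X0: "0 \<le> X" unfolding X_def using ld d by (intro mult_nonneg_nonneg beta_param_nonneg) (auto simp: d_def)
    show ?thesis
    proof (cases "X < 2 * b")
      case True
      have "c * X powr e \<le> 1 / (2 * b) powr e * (2 * b) powr e"
        using True X0 e c0 b by (intro mult_mono powr_mono2) (auto simp: c_def)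
      then have "c * X powr e \<le> 1" using b by simp
      moreover have "0 \<in> L \<inter> K"
        using zero_mem_lattice[OF L] sym_convex_body_facts(3)[OF K] by (metis IntI centre_in_ball subsetD)
      moreover have "card ({0} \<inter> V) \<le> r - 1" for V :: "(real^'n) set"
        using card_mono[of "{0}" "{0} \<inter> V"] r by simp
      ultimately show ?thesis unfolding X_def by (intro exI[of _ "{0}"]) auto
    next
      case False
      then have "2 \<le> X / b" using b by (simp add: le_divide_eq)
      then obtain p where p: "prime p" "real p \<le> X / b" "(X / b) powr (e / e') \<le> C * real p"
        using prime by blast
      have p1: "1 < p" using p(1) by (rule prime_gt_1_nat)
      have "18 * real d ^ 2 * real p \<le> X" using p(2) b by (simp add: b_def le_divide_eq mult.commute)
      then obtain v where v: "\<forall>i\<in>{1..d}. v i \<in> L \<and> v i \<notin> span (v ` {1..<i})"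
        and short: "\<forall>u\<in>residue_chart p d. \<exists>t w. 0 < t \<and> t < int p \<and>
          (\<forall>i\<in>{1..d}. [w i = t * u i] (mod int p)) \<and> (\<Sum>i=1..d. of_int (w i) *\<^sub>R v i) \<in> K"
        using exists_short_multiples_in_body[OF L K _ _ p1] d ld unfolding d_def X_def by auto
      obtain R where R: "R \<subseteq> residue_chart p d" "real p powr e' / (2 * real r) \<le> real (card R)"
        "\<And>g. card (R \<inter> residue_combinations p d k g) \<le> r - 1" using Rex[OF p1] by blast
      have "\<exists>S\<subseteq>L \<inter> K. card S = card R \<and> (\<forall>V. subspace V \<and> dim V = k \<longrightarrow> card (S \<inter> V) \<le> r - 1)"
      proof (rule exists_points_few_on_subspaces[OF p(1) _ _ R(1) _ R(3)])
        fix u assume "u \<in> R"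
        moreover have "(\<Sum>i=1..d. of_int (w i) *\<^sub>R v i) \<in> L" for w :: "nat \<Rightarrow> int"
          using v by (intro lattice_sum_mem[OF L]) auto
        ultimately show "\<exists>t w. 0 < t \<and> t < int p \<and> (\<forall>i\<in>{1..d}. [w i = t * u i] (mod int p)) \<and>
            (\<Sum>i=1..d. of_int (w i) *\<^sub>R v i) \<in> L \<inter> K" using short R(1) by (simp only: Int_iff simp_thms) blast
      qed (use d v in auto)
      then obtain S where S: "S \<subseteq> L \<inter> K" "card S = card R"
        "\<forall>V. subspace V \<and> dim V = k \<longrightarrow> card (S \<inter> V) \<le> r - 1" by blast
      have "(X / b) powr e = ((X / b) powr (e / e')) powr e'" using e by (simp add: powr_powr)
      also have "\<dots> \<le> (C * real p) powr e'" using p(3) e by (intro powr_mono2) auto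
      also have "\<dots> = C powr e' * real p powr e'" using C by (simp add: powr_mult)
      finally have "X powr e / b powr e \<le> C powr e' * real p powr e'" using X0 b by (simp add: powr_divide)
      then have "1 / (C powr e' * (2 * real r)) * (X powr e / b powr e) \<le>
          1 / (C powr e' * (2 * real r)) * (C powr e' * real p powr e')" by (intro mult_left_mono) auto
      also have "\<dots> = real p powr e' / (2 * real r)" using C by simp
      finally have "1 / (b powr e * C powr e' * (2 * real r)) * X powr e \<le> real p powr e' / (2 * real r)"
        by (simp add: mult_ac)
      moreover have "c * X powr e \<le> 1 / (b powr e * C powr e' * (2 * real r)) * X powr e"
        by (intro mult_right_mono) (simp_all add: c_def)
      ultimately have "c * X powr e \<le> real (card S)" using R(2) S(2) by linarith
      with S show ?thesis unfolding X_def by blast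
    qed
  qed
  then show ?thesis
    using r c0 unfolding d_def e_def by (intro exI[of _ r] conjI exI[of _ c] allI impI) auto
qed

end
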